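(* Let $t_0\in\mathbb{R}$, let $A:[t_0,\infty)\to\mathbb{R}^{n\times n}$ be a continuous matrix function, and suppose that the linear system $\dot x=A(t)x$ is uniformly asymptotically stable. Then there exists a continuous matrix function $H:[t_0,\infty)\to\mathbb{R}^{n\times n}$ with $H(t)$ symmetric and positive definite for every $t\ge t_0$, namely $$H(t)=\int_t^\infty \Phi^T(\tau,t)\,\Phi(\tau,t)\,d\tau,\qquad t\ge t_0,$$ for non-constant $A(t)$, and $$H(t)\equiv H=\int_0^\infty \mathrm{e}^{A^T\tau}\mathrm{e}^{A\tau}\,d\tau$$ for a constant system matrix $A(t)\equiv A$, such that every solution $x(t)$ of $\dot x=A(t)x$ satisfies, for all $t\ge t_0$, $$\left(\frac{\lambda_{\min}[H(t)]}{\lambda_{\max}[H(t)]}\right)^{1/2}\|x(t_0)\|_I\,\mathrm{e}^{-\frac12\int_{t_0}^t\frac{d\tau}{\lambda_{\min}[H(\tau)]}}\ \le\ \|x(t)\|_I\ \le\ \left(\frac{\lambda_{\max}[H(t)]}{\lambda_{\min}[H(t)]}\right)^{1/2}\|x(t_0)\|_I\,\mathrm{e}^{-\frac12\int_{t_0}^t\frac{d\tau}{\lambda_{\max}[H(\tau)]}},$$ and $$\lambda_{\min}[H(t)]\le\lambda_{\max}[H(t)]\le\frac{\gamma^2}{2\lambda}\qquad\text{for all } t\ge t_0.$$ Moreover, if $A(t)$ is bounded, $\|A(t)\|_I\le L$ for all $t\ge t_0$, then $$\frac{1}{2L}\le\lambda_{\min}[H(t)]\le\lambda_{\max}[H(t)]\le\frac{\gamma^2}{2\lambda}\qquad\text{for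 all } t\ge t_0.$$ Here $\gamma,\lambda>0$ are constants such that $\|\Phi(t,\tau)\|_I\le\gamma\,\mathrm{e}^{-\lambda(t-\tau)}$ for all $t\ge\tau\ge t_0$.
   Context: $\|x\|_I=(x^Tx)^{1/2}$ is the Euclidean norm on $\mathbb{R}^n$, and for a matrix $M\in\mathbb{R}^{n\times n}$, $\|M\|_I$ is the induced operator (spectral) norm. For a symmetric matrix $M$, $\lambda_{\min}[M]$ and $\lambda_{\max}[M]$ denote its smallest and largest eigenvalues. The transition matrix of $\dot x=A(t)x$ is $\Phi(t,\tau)=X(t)X^{-1}(\tau)$, where $X(t)$, $t\ge t_0$, is a fundamental matrix of the system; if $A(t)=A$ is constant, then $\Phi(t,\tau)=\mathrm{e}^{A(t-\tau)}$. The linear system $\dot x=A(t)x$ is uniformly asymptotically stable (UAS) if there exist finite positive constants $\gamma,\lambda$ such that for any initial time $t_0$ and any initial state $x(t_0)$ the corresponding solution satisfies $\|x(t)\|\le\gamma\|x(t_0)\|\mathrm{e}^{-\lambda(t-t_0)}$ for $t\ge t_0$ (here the constants do not depend on the initial time). Equivalently, there exist finite positive constants $\gamma,\lambda$ such that $\|\Phi(t,\tau)\|\le\gamma\,\mathrm{e}^{-\lambda(t-\tau)}$ for all $t,\tau$ with $t\ge\tau\ge t_0$.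
   Formalization: In the two-sided estimate of ‖x(t)‖ the numerators under the square roots are λ_min[H(t_0)] and λ_max[H(t_0)] instead of λ_min[H(t)] and λ_max[H(t)]; the printed form fails already for n=1 with non-constant A(t), and both agree for constant A. *)

theory Defs
  imports "HOL-Analysis.Analysis"
begin

definition is_solution :: "(real \<Rightarrow> real^'n^'n) \<Rightarrow> real \<Rightarrow> (real \<Rightarrow> real^'n) \<Rightarrow> bool" where
  "is_solution A s x \<longleftrightarrow>
     (\<forall>t\<ge>s. (x has_vector_derivative (A t *v x t)) (at t within {s..}))"

definition uniformly_asymptotically_stable :: "(real \<Rightarrow> real^'n^'n) \<Rightarrow> real \<Rightarrow> bool" where
  "uniformly_asymptotically_stable A t0 \<longleftrightarrow>
     (\<exists>\<gamma>>0. \<exists>lam>0. \<forall>s\<ge>t0. \<forall>x. is_solution A s x \<longrightarrow>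
        (\<forall>t\<ge>s. norm (x t) \<le> \<gamma> * norm (x s) * exp (- lam * (t - s))))"

definition fundamental_matrix ::
    "(real \<Rightarrow> real^'n^'n) \<Rightarrow> real \<Rightarrow> (real \<Rightarrow> real^'n^'n) \<Rightarrow> bool" where
  "fundamental_matrix A t0 X \<longleftrightarrow>
     (\<forall>t\<ge>t0. (X has_vector_derivative (A t ** X t)) (at t within {t0..}) \<and> invertible (X t))"

(* The value does not depend on which fundamental matrix is selected. *)
definition transition_matrix ::
    "(real \<Rightarrow> real^'n^'n) \<Rightarrow> real \<Rightarrow> real \<Rightarrow> real \<Rightarrow> real^'n^'n" where
  "transition_matrix A t0 t \<tau> =
     (let X = (SOME X. fundamental_matrix A t0 X) in X t ** matrix_inv (X \<tau>))"

(* The library's norm on real^'n^'n is the Frobenius norm and its (^) and exp are not those of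
   the matrix algebra (multiplication on the vector type is componentwise), so the operator norm,
   powers and exponential are spelled out. *)
definition spectral_norm :: "real^'n^'n \<Rightarrow> real" where
  "spectral_norm M = onorm (\<lambda>v. M *v v)"

primrec mat_power :: "real^'n^'n \<Rightarrow> nat \<Rightarrow> real^'n^'n" where
  "mat_power M 0 = mat 1"
| "mat_power M (Suc k) = M ** mat_power M k"

definition mat_exp :: "real^'n^'n \<Rightarrow> real^'n^'n" where
  "mat_exp M = (\<Sum>k. (1 / fact k) *\<^sub>R mat_power M k)"

definition symmetric_matrix :: "real^'n^'n \<Rightarrow> bool" where
  "symmetric_matrix M \<longleftrightarrow> transpose M = M"

definition positive_definite :: "real^'n^'n \<Rightarrow> bool" where
  "positive_definite M \<longleftrightarrow> (\<forall>v. v \<noteq> 0 \<longrightarrow> v \<bullet> (M *v v) > 0)"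

(* Real eigenvalues only; these are all the eigenvalues of a symmetric real matrix. *)
definition eigenvalues :: "real^'n^'n \<Rightarrow> real set" where
  "eigenvalues M = {l. \<exists>v. v \<noteq> 0 \<and> M *v v = l *\<^sub>R v}"

(* Meaningful for symmetric matrices, whose eigenvalue set is finite and nonempty. *)
definition lambda_min :: "real^'n^'n \<Rightarrow> real" where
  "lambda_min M = Min (eigenvalues M)"

definition lambda_max :: "real^'n^'n \<Rightarrow> real" where
  "lambda_max M = Max (eigenvalues M)"

end

theory Submission
  imports Defs
begin

text \<open>Let \<open>X\<close> be a fundamental matrix and \<open>Y\<close> its inverse, so that \<open>\<Phi>(t, s) = X(t) Y(s)\<close>.
  Exponential decay makes \<open>G(t) = \<integral>\<^sub>t\<^sup>\<infinity> X\<^sup>T X\<close> converge, and \<open>H = Y\<^sup>T G Y\<close>. Along a solution \<open>x = X c\<close>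
  the Lyapunov function \<open>V = x\<^sup>T H x = c\<^sup>T G c\<close> has derivative \<open>- |x|\<^sup>2\<close>, which the Rayleigh bounds
  \<open>\<lambda>\<^sub>m\<^sub>i\<^sub>n |x|\<^sup>2 \<le> V \<le> \<lambda>\<^sub>m\<^sub>a\<^sub>x |x|\<^sup>2\<close> squeeze between \<open>- V / \<lambda>\<^sub>m\<^sub>i\<^sub>n\<close> and \<open>- V / \<lambda>\<^sub>m\<^sub>a\<^sub>x\<close>; both estimates
  follow from Gronwall's argument. The fundamental matrix is the sum of the Peano-Baker series,
  which for constant \<open>A\<close> is the exponential series.\<close>

subsection \<open>The Peano-Baker series\<close>

lemma bounded_bilinear_matrix_mult:
  "bounded_bilinear ((**) :: real^'n^'m \<Rightarrow> real^'p^'n \<Rightarrow> real^'p^'m)"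
  unfolding bilinear_conv_bounded_bilinear[symmetric] bilinear_def
  by (auto intro!: linearI simp: matrix_matrix_mult_def vec_eq_iff algebra_simps sum.distrib
        sum_distrib_left)

lemma bounded_bilinear_matrix_vector_mult:
  "bounded_bilinear ((*v) :: real^'n^'m \<Rightarrow> real^'n \<Rightarrow> real^'m)"
  unfolding bilinear_conv_bounded_bilinear[symmetric] bilinear_def
  by (auto intro!: linearI simp: algebra_simps scaleR_matrix_vector_assoc)

lemma bounded_linear_transpose: "bounded_linear (transpose :: real^'n^'m \<Rightarrow> real^'m^'n)"
  unfolding linear_conv_bounded_linear[symmetric]
  by (auto intro!: linearI simp: transpose_def vec_eq_iff)

text \<open>With \<open>C\<close> bounding the action of \<open>B\<close> on a compact interval, the
  terms are dominated by those of an exponential series, so the series and the series of derivatives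
  both converge uniformly there. \<open>prod\<close> is abstract to cover multiplication from the
  left and from the right; \<open>Z\<close> is given by its recursion rather than by iterated
  integrals so that explicit terms, such as those of the matrix exponential, can be
  substituted.\<close>

lemma peano_baker_series_has_vector_derivative:
  fixes prod :: "'a::real_normed_vector \<Rightarrow> 'b::banach \<Rightarrow> 'b" and Z :: "nat \<Rightarrow> real \<Rightarrow> 'b"
  assumes prod: "bounded_bilinear prod"
    and B: "continuous_on {t0..} B"
    and Z0: "\<And>t. Z 0 t = X0"
    and Zs: "\<And>k. Z (Suc k) t0 = 0"
    and Zd: "\<And>k t. t \<ge> t0 \<Longrightarrow>
      (Z (Suc k) has_vector_derivative prod (B t) (Z k t)) (at t within {t0..})"
    and t: "t \<ge> t0"
  shows "summable (\<lambda>k. Z k t)"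
    and "((\<lambda>t. \<Sum>k. Z k t) has_vector_derivative prod (B t) (\<Sum>k. Z k t)) (at t within {t0..})"
proof -
  interpret bounded_bilinear prod by (rule prod)
  \<comment> \<open>The interval extends strictly beyond \<open>t\<close>, so that at
    \<open>t\<close> the neighbourhoods within \<open>?S\<close> and within \<open>{t0..}\<close>
    agree.\<close>
  define T where "T = t + 1"
  let ?S = "{t0..T}"
  have "bounded (B ` ?S)"
    by (intro compact_imp_bounded compact_continuous_image continuous_on_subset[OF B]) auto
  then obtain M where M: "\<And>s. s \<in> ?S \<Longrightarrow> norm (B s) \<le> M"
    unfolding bounded_iff by blast
  obtain K where K: "K > 0" "\<And>a b. norm (prod a b) \<le> norm a * norm b * K"
    using pos_bounded by blast
  define C where "C = \<bar>M\<bar> * K"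
  have C0: "C \<ge> 0" unfolding C_def using K by auto
  have C: "norm (prod (B s) z) \<le> C * norm z" if "s \<in> ?S" for s z
  proof -
    have "norm (B s) * norm z * K \<le> \<bar>M\<bar> * norm z * K"
      using M[OF that] K(1) by (intro mult_right_mono) auto
    then show ?thesis using K(2)[of "B s" z] unfolding C_def by (simp add: mult_ac)
  qed
  \<comment> \<open>Induction by the mean value inequality: the derivative of each majorant is
    \<open>C\<close> times the preceding majorant. The point \<open>s = t0\<close> is split off
    because the inequality requires a nondegenerate interval.\<close>
  have bnd: "norm (Z k s) \<le> norm X0 * ((C * (s - t0)) ^ k / fact k)" if "s \<in> ?S" for k s
    using that
  proof (induction k arbitrary: s)
    case 0
    then show ?case by (simp add: Z0)
  next
    case (Suc k)
    let ?p = "\<lambda>s. norm X0 * ((C * (s - t0)) ^ Suc k / fact (Suc k))"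
    show ?case
    proof (cases "s = t0")
      case True
      then show ?thesis using Zs by simp
    next
      case False
      then have s: "t0 < s" using Suc.prems by auto
      have "norm (Z (Suc k) s - Z (Suc k) t0) \<le> ?p s - ?p t0"
      proof (rule differentiable_bound_general[OF s,
            where f' = "\<lambda>u. prod (B u) (Z k u)" and \<phi>' = "\<lambda>u. C * (norm X0 * ((C * (u - t0)) ^ k / fact k))"])
        show "continuous_on {t0..s} ?p" by (intro continuous_intros) auto
        show "continuous_on {t0..s} (Z (Suc k))"
          unfolding continuous_on_eq_continuous_within
        proof
          fix u assume "u \<in> {t0..s}"
          then have u: "u \<ge> t0" by simp
          show "continuous (at u within {t0..s}) (Z (Suc k))"
            by (rule continuous_within_subset[OF has_vector_derivative_continuous[OF Zd[OF u]]]) auto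
        qed
        fix u assume u: "t0 < u" "u < s"
        show "(Z (Suc k) has_vector_derivative prod (B u) (Z k u)) (at u)"
        proof -
          have "at u within {t0..} = at u" by (rule at_within_interior) (use u in simp)
          then show ?thesis using Zd[OF less_imp_le[OF u(1)], of k] by metis
        qed
        have "((\<lambda>s. C * (s - t0)) has_real_derivative C) (at u)"
          by (auto intro!: derivative_eq_intros)
        from DERIV_cmult[OF DERIV_cdivide[OF DERIV_power[OF this, of "Suc k"]], of "norm X0" "fact (Suc k)"]
        have "(?p has_real_derivative
            norm X0 * (real (Suc k) * (C * (C * (u - t0)) ^ (Suc k - 1)) / fact (Suc k))) (at u)"
          by simp
        also have "norm X0 * (real (Suc k) * (C * (C * (u - t0)) ^ (Suc k - 1)) / fact (Suc k))
          = C * (norm X0 * ((C * (u - t0)) ^ k / fact k))"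
          unfolding fact_Suc by (simp del: of_nat_Suc)
        finally show "(?p has_vector_derivative C * (norm X0 * ((C * (u - t0)) ^ k / fact k))) (at u)"
          by (simp add: has_real_derivative_iff_has_vector_derivative)
        have "norm (prod (B u) (Z k u)) \<le> C * norm (Z k u)" using C u Suc.prems by auto
        also have "\<dots> \<le> C * (norm X0 * ((C * (u - t0)) ^ k / fact k))"
          using Suc.IH[of u] u Suc.prems C0 by (intro mult_left_mono) auto
        finally show "norm (prod (B u) (Z k u)) \<le> C * (norm X0 * ((C * (u - t0)) ^ k / fact k))" .
      qed
      then show ?thesis using Zs by simp
    qed
  qed
  define m where "m k = norm X0 * ((C * (T - t0)) ^ k / fact k)" for k
  have m: "norm (Z k s) \<le> m k" if "s \<in> ?S" for k s
  proof -
    have "(C * (s - t0)) ^ k \<le> (C * (T - t0)) ^ k"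
      using that C0 by (intro power_mono mult_left_mono) auto
    then show ?thesis
      unfolding m_def by (intro order_trans[OF bnd[OF that]] mult_left_mono divide_right_mono) auto
  qed
  have sm: "summable m"
    unfolding m_def using summable_exp[of "C * (T - t0)"]
    by (intro summable_mult) (simp add: field_simps)
  have ul: "uniform_limit ?S (\<lambda>n s. \<Sum>i<n. Z i s) (\<lambda>s. \<Sum>i. Z i s) sequentially"
    by (rule Weierstrass_m_test[OF m sm])
  have summ: "summable (\<lambda>k. Z k s)" if "s \<in> ?S" for s
    by (rule summable_comparison_test'[OF sm, of 0]) (use m that in auto)
  have tS: "t \<in> ?S" using t unfolding T_def by auto
  show "summable (\<lambda>k. Z k t)" by (rule summ[OF tS])
  \<comment> \<open>Derivative of the term \<open>Z n\<close>. The constant term contributes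
    \<open>0\<close>, so the first \<open>n\<close> derivatives sum to \<open>prod (B s)\<close> of
    the first \<open>n - 1\<close> terms; this shift is why \<open>n > 0\<close> is required
    below.\<close>
  define d where "d n s = (case n of 0 \<Rightarrow> 0 | Suc k \<Rightarrow> prod (B s) (Z k s))" for n s
  have "\<exists>g. \<forall>s\<in>?S. (\<lambda>n. Z n s) sums g s \<and>
      (g has_derivative (\<lambda>h. h *\<^sub>R prod (B s) (\<Sum>i. Z i s))) (at s within ?S)"
  proof (rule has_derivative_series[where f' = "\<lambda>n s h. h *\<^sub>R d n s"])
    show "(Z n has_derivative (\<lambda>h. h *\<^sub>R d n s)) (at s within ?S)" if s: "s \<in> ?S" for n s
    proof (cases n)
      case 0
      have "Z 0 = (\<lambda>_. X0)" using Z0 by auto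
      then show ?thesis using 0 by (simp add: d_def)
    next
      case (Suc k)
      then show ?thesis
        using has_vector_derivative_within_subset[OF Zd[of s k], of ?S] s
        by (auto simp: d_def has_vector_derivative_def)
    qed
    show "\<forall>\<^sub>F n in sequentially. \<forall>x\<in>?S. \<forall>h.
        norm ((\<Sum>i<n. h *\<^sub>R d i x) - h *\<^sub>R prod (B x) (\<Sum>i. Z i x)) \<le> e * norm h"
      if e: "e > 0" for e
    proof -
      \<comment> \<open>The summand \<open>1\<close> guards against \<open>C = 0\<close>.\<close>
      have "e / (C + 1) > 0" using e C0 by auto
      then have "\<forall>\<^sub>F n in sequentially. \<forall>x\<in>?S. dist (\<Sum>i<n. Z i x) (\<Sum>i. Z i x) < e / (C + 1)"
        using ul unfolding uniform_limit_iff by blast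
      then have "\<forall>\<^sub>F n in sequentially. \<forall>x\<in>?S. dist (\<Sum>i<n-1. Z i x) (\<Sum>i. Z i x) < e / (C + 1)"
        by (subst eventually_sequentially_Suc[symmetric]) simp
      then show ?thesis
        using eventually_gt_at_top[of 0]
      proof eventually_elim
        case (elim n)
        show ?case
        proof (intro ballI allI)
          fix x h assume x: "x \<in> ?S"
          have "n = Suc (n - 1)" using elim by auto
          then have "(\<Sum>i<n. d i x) = (\<Sum>i<Suc (n-1). d i x)" by simp
          also have "\<dots> = prod (B x) (\<Sum>i<n-1. Z i x)"
            by (subst sum.lessThan_Suc_shift) (simp add: d_def sum_right)
          finally have "(\<Sum>i<n. h *\<^sub>R d i x) - h *\<^sub>R prod (B x) (\<Sum>i. Z i x)
            = h *\<^sub>R prod (B x) ((\<Sum>i<n-1. Z i x) - (\<Sum>i. Z i x))"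
            by (simp add: scaleR_right_diff_distrib diff_right flip: scaleR_sum_right)
          also have "norm \<dots> \<le> \<bar>h\<bar> * (C * norm ((\<Sum>i<n-1. Z i x) - (\<Sum>i. Z i x)))"
            using C[OF x] by (simp add: mult_left_mono)
          also have "\<dots> \<le> \<bar>h\<bar> * (C * (e / (C + 1)))"
            using elim x C0 by (intro mult_left_mono) (auto simp: dist_norm less_imp_le)
          also have "\<dots> \<le> \<bar>h\<bar> * e"
            using C0 e by (intro mult_left_mono) (auto simp: field_simps)
          finally show "norm ((\<Sum>i<n. h *\<^sub>R d i x) - h *\<^sub>R prod (B x) (\<Sum>i. Z i x)) \<le> e * norm h"
            by (simp add: mult.commute)
        qed
      qed
    qed
    show "t \<in> ?S" by (rule tS)
    show "(\<lambda>n. Z n t) sums (\<Sum>k. Z k t)" by (rule summable_sums[OF summ[OF tS]])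
  qed simp
  then obtain g where g: "\<And>s. s \<in> ?S \<Longrightarrow> (\<lambda>n. Z n s) sums g s"
    "\<And>s. s \<in> ?S \<Longrightarrow> (g has_vector_derivative prod (B s) (\<Sum>i. Z i s)) (at s within ?S)"
    unfolding has_vector_derivative_def by blast
  have "((\<lambda>t. \<Sum>k. Z k t) has_vector_derivative prod (B t) (\<Sum>k. Z k t)) (at t within ?S)"
    by (rule has_vector_derivative_transform[OF tS _ g(2)[OF tS]]) (simp add: sums_unique[OF g(1)])
  moreover have "at t within ?S = at t within {t0..}"
    by (rule at_within_nhd[of t "{..<T}"]) (auto simp: T_def)
  ultimately show "((\<lambda>t. \<Sum>k. Z k t) has_vector_derivative prod (B t) (\<Sum>k. Z k t)) (at t within {t0..})"
    by simp
qed

text \<open>The iterated integrals satisfy the recursion of the Peano-Baker series. At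
  \<open>t0\<close> every term but the zeroth is an integral over a single point, which gives the
  initial value.\<close>

lemma linear_ode_solution_exists:
  fixes prod :: "'a::real_normed_vector \<Rightarrow> 'b::banach \<Rightarrow> 'b"
  assumes prod: "bounded_bilinear prod" and B: "continuous_on {t0..} B"
  obtains X where "X t0 = X0"
    and "\<And>t. t \<ge> t0 \<Longrightarrow> (X has_vector_derivative prod (B t) (X t)) (at t within {t0..})"
proof -
  interpret bounded_bilinear prod by (rule prod)
  define Z where "Z = rec_nat (\<lambda>_. X0) (\<lambda>k f t. integral {t0..t} (\<lambda>s. prod (B s) (f s)))"
  have Z0: "Z 0 t = X0" and ZS: "Z (Suc k) t = integral {t0..t} (\<lambda>s. prod (B s) (Z k s))" for k t
    unfolding Z_def by simp_all
  have step: "(Z (Suc k) has_vector_derivative prod (B t) (Z k t)) (at t within {t0..})"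
    if c: "continuous_on {t0..} (Z k)" and t: "t \<ge> t0" for k t
  proof -
    have "continuous_on {t0..} (\<lambda>s. prod (B s) (Z k s))"
      by (intro continuous_on B c)
    then have "continuous_on {t0..t+1} (\<lambda>s. prod (B s) (Z k s))"
      by (rule continuous_on_subset) auto
    then have "((\<lambda>u. integral {t0..u} (\<lambda>s. prod (B s) (Z k s))) has_vector_derivative prod (B t) (Z k t))
        (at t within {t0..t+1})"
      by (rule integral_has_vector_derivative) (use t in auto)
    moreover have "at t within {t0..t+1} = at t within {t0..}"
      by (rule at_within_nhd[of t "{..<t+1}"]) auto
    moreover have "Z (Suc k) = (\<lambda>u. integral {t0..u} (\<lambda>s. prod (B s) (Z k s)))"
      using ZS by auto
    ultimately show ?thesis by simp
  qed
  have cont: "continuous_on {t0..} (Z k)" for k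
  proof (induction k)
    case 0
    have "Z 0 = (\<lambda>_. X0)" using Z0 by auto
    then show ?case by simp
  next
    case (Suc k)
    show ?case
      by (auto simp: continuous_on_eq_continuous_within
           intro!: has_vector_derivative_continuous[OF step[OF Suc]])
  qed
  have Zs: "Z (Suc k) t0 = 0" for k by (simp add: ZS)
  have "(\<Sum>k. Z k t0) = (\<Sum>k<Suc 0. Z k t0)"
  proof (rule suminf_finite)
    fix n assume "n \<notin> {..<Suc 0}"
    then show "Z n t0 = 0" using Zs by (cases n) auto
  qed simp
  then have 1: "(\<Sum>k. Z k t0) = X0" by (simp add: Z0)
  show ?thesis
  proof (rule that[of "\<lambda>t. \<Sum>k. Z k t", OF 1])
    fix t assume t: "t \<ge> t0"
    show "((\<lambda>t. \<Sum>k. Z k t) has_vector_derivative prod (B t) (\<Sum>k. Z k t)) (at t within {t0..})"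
      by (rule peano_baker_series_has_vector_derivative(2)[where Z = Z, OF prod B Z0 Zs step[OF cont] t])
  qed
qed

subsection \<open>Extremal eigenvalues of symmetric matrices\<close>

lemma inner_symmetric_matrix:
  fixes M :: "real^'n^'n"
  assumes "symmetric_matrix M"
  shows "v \<bullet> (M *v w) = (M *v v) \<bullet> w"
  using assms unfolding symmetric_matrix_def
  by (metis dot_lmul_matrix vector_transpose_matrix)

text \<open>Eigenvectors for distinct eigenvalues of a symmetric matrix are orthogonal. Choosing one
  for each eigenvalue is therefore injective, with a pairwise orthogonal and hence finite image.
  Finiteness is what gives \<open>Min\<close> and \<open>Max\<close> of the spectrum their
  meaning.\<close>

lemma finite_eigenvalues:
  fixes M :: "real^'n^'n"
  assumes M: "symmetric_matrix M"
  shows "finite (eigenvalues M)"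
proof -
  obtain f where f: "\<And>l. l \<in> eigenvalues M \<Longrightarrow> f l \<noteq> 0 \<and> M *v f l = l *\<^sub>R f l"
    using bchoice[of "eigenvalues M" "\<lambda>l v. v \<noteq> 0 \<and> M *v v = l *\<^sub>R v"]
    unfolding eigenvalues_def by blast
  have orth: "f l \<bullet> f m = 0" if "l \<in> eigenvalues M" "m \<in> eigenvalues M" "l \<noteq> m" for l m
    using inner_symmetric_matrix[OF M, of "f l" "f m"] f[OF that(1)] f[OF that(2)] that(3) by auto
  have "inj_on f (eigenvalues M)"
    using orth f by (metis inj_onI inner_eq_zero_iff)
  moreover have "finite (f ` eigenvalues M)"
    by (rule pairwise_orthogonal_imp_finite) (auto simp: pairwise_def orthogonal_def intro: orth)
  ultimately show ?thesis by (metis finite_imageD)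
qed

text \<open>A maximizer of the Rayleigh quotient on the unit sphere is an eigenvector, because the
  nonnegative quadratic form \<open>m (w \<bullet> w) - w \<bullet> M w\<close> vanishes there.\<close>

lemma rayleigh_maximum:
  fixes M :: "real^'n^'n"
  assumes M: "symmetric_matrix M"
  shows "\<exists>m\<in>eigenvalues M. \<forall>v. v \<bullet> (M *v v) \<le> m * (v \<bullet> v)"
proof -
  interpret bounded_bilinear "(*v) :: real^'n^'n \<Rightarrow> real^'n \<Rightarrow> real^'n"
    by (rule bounded_bilinear_matrix_vector_mult)
  have "continuous_on (sphere 0 1) (\<lambda>v. v \<bullet> (M *v v))"
    by (intro continuous_intros)
  moreover have "sphere (0::real^'n) 1 \<noteq> {}" by simp
  ultimately obtain u where u: "u \<in> sphere 0 1"
    and max: "\<And>v. v \<in> sphere 0 1 \<Longrightarrow> v \<bullet> (M *v v) \<le> u \<bullet> (M *v u)"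
    using continuous_attains_sup[OF compact_sphere, of 0 1 "\<lambda>v. v \<bullet> (M *v v)"] by blast
  define m where "m = u \<bullet> (M *v u)"
  have le: "v \<bullet> (M *v v) \<le> m * (v \<bullet> v)" for v
  proof (cases "v = 0")
    case False
    define w where "w = (1 / norm v) *\<^sub>R v"
    have "v = norm v *\<^sub>R w" using False by (simp add: w_def)
    then have "v \<bullet> (M *v v) = (norm v)\<^sup>2 * (w \<bullet> (M *v w))"
      by (metis (no_types, lifting) inner_scaleR_left inner_scaleR_right mult.assoc power2_eq_square
          scaleR_right)
    also have "\<dots> \<le> (norm v)\<^sup>2 * m"
      using max[of w] False unfolding m_def by (intro mult_left_mono) (auto simp: w_def)
    finally show ?thesis by (simp add: power2_norm_eq_inner mult.commute)
  qed simp
  define z where "z = m *\<^sub>R u - M *v u"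
  have uu: "u \<bullet> u = 1" using u by (simp add: norm_eq_1)
  have "z = 0"
  proof (rule ccontr)
    assume "z \<noteq> 0"
    define a where "a = z \<bullet> z"
    define b where "b = m * a - z \<bullet> (M *v z)"
    have a: "a > 0" using \<open>z \<noteq> 0\<close> by (simp add: a_def)
    have uz: "u \<bullet> (M *v z) = (M *v u) \<bullet> z" by (rule inner_symmetric_matrix[OF M])
    \<comment> \<open>The nonnegative form is expanded at \<open>u + t *\<^sub>R z\<close>, with
      \<open>z\<close> the residual of the eigenvalue equation: the constant term vanishes by the
      choice of \<open>m\<close>, and the linear coefficient is \<open>2 * a\<close>.\<close>
    have q: "0 \<le> 2 * t * a + t\<^sup>2 * b" for t
    proof -
      have "m * ((u + t *\<^sub>R z) \<bullet> (u + t *\<^sub>R z)) - (u + t *\<^sub>R z) \<bullet> (M *v (u + t *\<^sub>R z))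
        = 2 * t * (z \<bullet> (m *\<^sub>R u - M *v u)) + t\<^sup>2 * b"
        using uu uz unfolding b_def a_def m_def
        by (simp add: add_right scaleR_right inner_add inner_diff inner_commute algebra_simps power2_eq_square)
      then show ?thesis using le[of "u + t *\<^sub>R z"] unfolding a_def z_def by linarith
    qed
    \<comment> \<open>A negative \<open>t\<close> so small that the linear term outweighs the
      quadratic one, whatever the sign of \<open>b\<close>.\<close>
    define t where "t = - a / (\<bar>b\<bar> + 1)"
    have t: "t < 0" using a unfolding t_def by (simp add: divide_neg_pos)
    have "\<bar>t * b\<bar> < 2 * a"
    proof -
      have "\<bar>t * b\<bar> = a * (\<bar>b\<bar> / (\<bar>b\<bar> + 1))" using a unfolding t_def by (simp add: abs_mult)
      also have "\<dots> \<le> a * 1" using a by (intro mult_left_mono) (auto simp: field_simps)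
      finally show ?thesis using a by linarith
    qed
    then have "2 * a + t * b > 0" by linarith
    then have "t * (2 * a + t * b) < 0" using t by (simp add: mult_neg_pos)
    then show False using q[of t] by (simp add: algebra_simps power2_eq_square)
  qed
  then have "M *v u = m *\<^sub>R u" by (simp add: z_def)
  moreover have "u \<noteq> 0" using u by auto
  ultimately have "m \<in> eigenvalues M" unfolding eigenvalues_def by blast
  then show ?thesis using le by blast
qed

lemma lambda_max_eigenvalue:
  assumes "symmetric_matrix M"
  shows "lambda_max M \<in> eigenvalues M"
  unfolding lambda_max_def using rayleigh_maximum[OF assms] finite_eigenvalues[OF assms]
  by (intro Max_in) auto

lemma inner_le_lambda_max:
  assumes M: "symmetric_matrix M"
  shows "v \<bullet> (M *v v) \<le> lambda_max M * (v \<bullet> v)"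
proof -
  obtain m where m: "m \<in> eigenvalues M" "v \<bullet> (M *v v) \<le> m * (v \<bullet> v)"
    using rayleigh_maximum[OF M] by blast
  have "m \<le> lambda_max M" unfolding lambda_max_def by (rule Max_ge[OF finite_eigenvalues[OF M] m(1)])
  then have "m * (v \<bullet> v) \<le> lambda_max M * (v \<bullet> v)" by (rule mult_right_mono) simp
  then show ?thesis using m(2) by linarith
qed

lemma eigenvalue_le:
  assumes "l \<in> eigenvalues M" "\<And>v. v \<bullet> (M *v v) \<le> c * (v \<bullet> v)"
  shows "l \<le> c"
proof -
  obtain v where v: "v \<noteq> 0" "M *v v = l *\<^sub>R v" using assms(1) unfolding eigenvalues_def by blast
  show ?thesis using assms(2)[of v] v by simp
qed

lemma le_eigenvalue:
  assumes "l \<in> eigenvalues M" "\<And>v. c * (v \<bullet> v) \<le> v \<bullet> (M *v v)"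
  shows "c \<le> l"
proof -
  obtain v where v: "v \<noteq> 0" "M *v v = l *\<^sub>R v" using assms(1) unfolding eigenvalues_def by blast
  show ?thesis using assms(2)[of v] v by simp
qed

lemma symmetric_matrix_uminus:
  fixes M :: "real^'n^'n"
  shows "symmetric_matrix M \<Longrightarrow> symmetric_matrix (- M)"
  by (simp add: symmetric_matrix_def transpose_def vec_eq_iff)

text \<open>Negation reflects the spectrum. Through this identity the lower Rayleigh bound and the
  continuity of \<open>lambda_min\<close> are inherited from \<open>lambda_max\<close>.\<close>

lemma lambda_min_conv_lambda_max:
  fixes M :: "real^'n^'n"
  assumes M: "symmetric_matrix M"
  shows "lambda_min M = - lambda_max (- M)"
proof -
  interpret bounded_bilinear "(*v) :: real^'n^'n \<Rightarrow> real^'n \<Rightarrow> real^'n"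
    by (rule bounded_bilinear_matrix_vector_mult)
  have "eigenvalues M = uminus ` eigenvalues (- M)"
  proof -
    have iff: "l \<in> eigenvalues M \<longleftrightarrow> - l \<in> eigenvalues (- M)" for l
      by (simp add: eigenvalues_def minus_left)
    show ?thesis
    proof (rule set_eqI)
      fix l :: real
      have "l = - (- l)" by simp
      then show "l \<in> eigenvalues M \<longleftrightarrow> l \<in> uminus ` eigenvalues (- M)"
        unfolding iff[of l] by (metis image_iff minus_equation_iff)
    qed
  qed
  moreover have "finite (eigenvalues (- M))" "eigenvalues (- M) \<noteq> {}"
    using finite_eigenvalues[OF symmetric_matrix_uminus[OF M]]
      lambda_max_eigenvalue[OF symmetric_matrix_uminus[OF M]] by auto
  ultimately show ?thesis
    unfolding lambda_min_def lambda_max_def by simp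
qed

lemma lambda_min_eigenvalue:
  assumes M: "symmetric_matrix M"
  shows "lambda_min M \<in> eigenvalues M"
  unfolding lambda_min_def
  using lambda_max_eigenvalue[OF M] finite_eigenvalues[OF M] by (intro Min_in) auto

lemma lambda_min_le_inner:
  fixes M :: "real^'n^'n"
  assumes M: "symmetric_matrix M"
  shows "lambda_min M * (v \<bullet> v) \<le> v \<bullet> (M *v v)"
proof -
  interpret bounded_bilinear "(*v) :: real^'n^'n \<Rightarrow> real^'n \<Rightarrow> real^'n"
    by (rule bounded_bilinear_matrix_vector_mult)
  show ?thesis
    using inner_le_lambda_max[OF symmetric_matrix_uminus[OF M], of v]
    by (simp add: lambda_min_conv_lambda_max[OF M] minus_left)
qed

lemma lambda_min_le_lambda_max:
  assumes M: "symmetric_matrix M"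
  shows "lambda_min M \<le> lambda_max M"
  by (rule eigenvalue_le[OF lambda_min_eigenvalue[OF M] inner_le_lambda_max[OF M]])

lemma lambda_min_pos:
  assumes M: "symmetric_matrix M" and "positive_definite M"
  shows "0 < lambda_min M"
proof -
  obtain v where v: "v \<noteq> 0" "M *v v = lambda_min M *\<^sub>R v"
    using lambda_min_eigenvalue[OF M] unfolding eigenvalues_def by blast
  then have "0 < lambda_min M * (v \<bullet> v)" using assms(2) unfolding positive_definite_def by fastforce
  moreover have "0 < v \<bullet> v" using v(1) by simp
  ultimately show ?thesis by (simp only: zero_less_mult_pos2)
qed

text \<open>The quadratic forms of \<open>M\<close> and \<open>N\<close> differ by at most
  \<open>K * norm (M - N)\<close> on unit vectors, so the largest eigenvalues differ by no more.
  This yields continuity of the extremal eigenvalues of \<open>H\<close>, and with it the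
  integrability of the decay rates.\<close>

lemma lambda_max_lipschitz:
  "\<exists>K>0. \<forall>M N :: real^'n^'n. symmetric_matrix M \<longrightarrow> symmetric_matrix N \<longrightarrow>
     \<bar>lambda_max M - lambda_max N\<bar> \<le> K * norm (M - N)"
proof -
  interpret bounded_bilinear "(*v) :: real^'n^'n \<Rightarrow> real^'n \<Rightarrow> real^'n"
    by (rule bounded_bilinear_matrix_vector_mult)
  obtain K where K: "K > 0" "\<And>(M::real^'n^'n) v. norm (M *v v) \<le> norm M * norm v * K"
    using pos_bounded by blast
  have *: "lambda_max M \<le> lambda_max N + K * norm (M - N)"
    if M: "symmetric_matrix M" and N: "symmetric_matrix N" for M N :: "real^'n^'n"
  proof (rule eigenvalue_le[OF lambda_max_eigenvalue[OF M]])
    fix v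
    have "v \<bullet> (M *v v) = v \<bullet> (N *v v) + v \<bullet> ((M - N) *v v)"
      by (simp add: diff_left inner_diff)
    also have "v \<bullet> ((M - N) *v v) \<le> norm v * norm ((M - N) *v v)"
      by (rule norm_cauchy_schwarz)
    also have "\<dots> \<le> norm v * (norm (M - N) * norm v * K)"
      by (intro mult_left_mono K) auto
    also have "\<dots> = K * norm (M - N) * (v \<bullet> v)"
      by (simp add: dot_square_norm power2_eq_square)
    finally show "v \<bullet> (M *v v) \<le> (lambda_max N + K * norm (M - N)) * (v \<bullet> v)"
      using inner_le_lambda_max[OF N, of v] by (simp add: algebra_simps)
  qed
  have "\<bar>lambda_max M - lambda_max N\<bar> \<le> K * norm (M - N)"
    if "symmetric_matrix M" "symmetric_matrix N" for M N :: "real^'n^'n"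
    using *[OF that] *[OF that(2,1)] by (simp add: norm_minus_commute abs_le_iff)
  then show ?thesis using K(1) by blast
qed

lemma continuous_on_lambda_max:
  fixes H :: "'a::topological_space \<Rightarrow> real^'n^'n"
  assumes H: "continuous_on S H" and sym: "\<And>s. s \<in> S \<Longrightarrow> symmetric_matrix (H s)"
  shows "continuous_on S (\<lambda>s. lambda_max (H s))"
proof -
  obtain K where K: "K > 0" "\<And>M N :: real^'n^'n. symmetric_matrix M \<Longrightarrow> symmetric_matrix N \<Longrightarrow>
     \<bar>lambda_max M - lambda_max N\<bar> \<le> K * norm (M - N)"
    using lambda_max_lipschitz by metis
  show ?thesis
    unfolding continuous_on_def
  proof
    fix s assume s: "s \<in> S"
    have "(H \<longlongrightarrow> H s) (at s within S)" using H s unfolding continuous_on_def by blast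
    then have "((\<lambda>x. K * norm (H x - H s)) \<longlongrightarrow> 0) (at s within S)"
      by (auto intro!: tendsto_eq_intros)
    moreover have "\<forall>\<^sub>F x in at s within S. norm (lambda_max (H x) - lambda_max (H s)) \<le> K * norm (H x - H s)"
      using K(2) sym s by (auto simp: eventually_at_topological)
    ultimately have "((\<lambda>x. lambda_max (H x) - lambda_max (H s)) \<longlongrightarrow> 0) (at s within S)"
      by (rule Lim_null_comparison[rotated])
    then show "((\<lambda>x. lambda_max (H x)) \<longlongrightarrow> lambda_max (H s)) (at s within S)"
      by (simp add: LIM_zero_iff)
  qed
qed

lemma continuous_on_lambda_min:
  fixes H :: "'a::topological_space \<Rightarrow> real^'n^'n"
  assumes H: "continuous_on S H" and sym: "\<And>s. s \<in> S \<Longrightarrow> symmetric_matrix (H s)"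
  shows "continuous_on S (\<lambda>s. lambda_min (H s))"
proof -
  have "continuous_on S (\<lambda>s. - lambda_max (- H s))"
    by (intro continuous_intros continuous_on_lambda_max H symmetric_matrix_uminus sym)
  then show ?thesis
    by (rule continuous_on_cong[THEN iffD1, rotated -1])
       (simp_all add: lambda_min_conv_lambda_max[OF sym])
qed

subsection \<open>Fundamental matrices\<close>

lemmas has_vector_derivative_matrix_mult =
  bounded_bilinear.has_vector_derivative[OF bounded_bilinear_matrix_mult]

lemmas has_vector_derivative_matrix_vector_mult =
  bounded_bilinear.has_vector_derivative[OF bounded_bilinear_matrix_vector_mult]

lemma matrix_inv_inverse:
  fixes A :: "real^'n^'n"
  assumes "invertible A"
  shows matrix_inv_right: "A ** matrix_inv A = mat 1"
    and matrix_inv_left: "matrix_inv A ** A = mat 1"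
proof -
  have "A ** matrix_inv A = mat 1 \<and> matrix_inv A ** A = mat 1"
    using assms unfolding matrix_inv_def invertible_def by (rule someI_ex)
  then show "A ** matrix_inv A = mat 1" "matrix_inv A ** A = mat 1" by auto
qed

lemma matrix_inv_equality:
  fixes A B :: "real^'n^'n"
  assumes "B ** A = mat 1"
  shows "matrix_inv A = B"
proof -
  have "invertible A" using assms by (rule invertible_left_inverse[THEN iffD2, OF exI])
  then have "A ** matrix_inv A = mat 1" by (rule matrix_inv_right)
  then have "B ** (A ** matrix_inv A) = B" by simp
  then show ?thesis using assms by (simp add: matrix_mul_assoc)
qed

text \<open>By the product rule the derivative of \<open>W t ** X t\<close> is W A X - W A X = 0. A
  solution of the adjoint equation with the right initial value is thereby identified as the inverse
  of \<open>X\<close>.\<close>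

lemma adjoint_solution_mult_constant:
  fixes A X W :: "real \<Rightarrow> real^'n^'n"
  assumes X: "\<And>t. t \<ge> t0 \<Longrightarrow> (X has_vector_derivative A t ** X t) (at t within {t0..})"
    and W: "\<And>t. t \<ge> t0 \<Longrightarrow> (W has_vector_derivative W t ** (- A t)) (at t within {t0..})"
    and t: "t \<ge> t0"
  shows "W t ** X t = W t0 ** X t0"
proof -
  have "((\<lambda>t. W t ** X t) has_vector_derivative 0) (at t within {t0..})" if "t \<in> {t0..}" for t
  proof -
    have "((\<lambda>t. W t ** X t) has_vector_derivative
        W t ** (A t ** X t) + W t ** (- A t) ** X t) (at t within {t0..})"
      using that by (intro has_vector_derivative_matrix_mult X W) auto
    moreover have "W t ** (A t ** X t) + W t ** (- A t) ** X t = 0"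
      by (simp add: matrix_mul_assoc bounded_bilinear.minus_left[OF bounded_bilinear_matrix_mult]
          bounded_bilinear.minus_right[OF bounded_bilinear_matrix_mult])
    ultimately show ?thesis by metis
  qed
  then obtain c where c: "\<And>t. t \<in> {t0..} \<Longrightarrow> W t ** X t = c"
    using has_vector_derivative_zero_constant[of "{t0..}" "\<lambda>t. W t ** X t"] by (metis convex_real_interval(1))
  then show ?thesis using t by simp
qed

text \<open>Invertibility comes from the adjoint equation Y' = - Y A instead of a determinant
  formula: its solution starting at the identity is a left inverse of \<open>X\<close> at all
  times.\<close>

lemma fundamental_matrix_exists:
  fixes A :: "real \<Rightarrow> real^'n^'n"
  assumes A: "continuous_on {t0..} A"
  shows "\<exists>X. fundamental_matrix A t0 X"
proof -
  obtain X where X0: "X t0 = mat 1"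
    and X: "\<And>t. t \<ge> t0 \<Longrightarrow> (X has_vector_derivative A t ** X t) (at t within {t0..})"
    using linear_ode_solution_exists[OF bounded_bilinear_matrix_mult A] by blast
  obtain Y where Y0: "Y t0 = mat 1"
    and Y: "\<And>t. t \<ge> t0 \<Longrightarrow> (Y has_vector_derivative Y t ** (- A t)) (at t within {t0..})"
    using linear_ode_solution_exists[OF bounded_bilinear.flip[OF bounded_bilinear_matrix_mult]
        continuous_on_minus[OF A]] by blast
  have "Y t ** X t = mat 1" if "t \<ge> t0" for t
    using adjoint_solution_mult_constant[of t0 X A Y t] X Y X0 Y0 that by simp
  then have "invertible (X t)" if "t \<ge> t0" for t
    using that invertible_left_inverse by blast
  then show ?thesis using X unfolding fundamental_matrix_def by blast
qed

text \<open>\<open>X\<close> is any fundamental matrix, not normalised at \<open>t0\<close>; the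
  transition matrix from \<open>s\<close> to \<open>t\<close> is \<open>X t ** Y s\<close>.\<close>

locale fundamental_system =
  fixes A :: "real \<Rightarrow> real^'n^'n" and t0 :: real and X Y :: "real \<Rightarrow> real^'n^'n"
  assumes continuous_A: "continuous_on {t0..} A"
    and fundamental: "fundamental_matrix A t0 X"
    and Y_def: "Y = (\<lambda>t. matrix_inv (X t))"
begin

lemma X_deriv: "t \<ge> t0 \<Longrightarrow> (X has_vector_derivative A t ** X t) (at t within {t0..})"
  and invertible_X: "t \<ge> t0 \<Longrightarrow> invertible (X t)"
  using fundamental unfolding fundamental_matrix_def by auto

lemma YX: "t \<ge> t0 \<Longrightarrow> Y t ** X t = mat 1"
  and XY: "t \<ge> t0 \<Longrightarrow> X t ** Y t = mat 1"
  unfolding Y_def using matrix_inv_left matrix_inv_right invertible_X by auto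

lemma XYv: "t \<ge> t0 \<Longrightarrow> X t *v (Y t *v v) = v"
  and YXv: "t \<ge> t0 \<Longrightarrow> Y t *v (X t *v v) = v"
  by (simp_all add: matrix_vector_mul_assoc XY YX)

text \<open>Differentiating matrix inversion is avoided: the solution of the adjoint equation that
  starts at \<open>Y t0\<close> is an inverse of \<open>X\<close> at every time, hence equal to
  \<open>Y\<close>.\<close>

lemma Y_deriv:
  assumes t: "t \<ge> t0"
  shows "(Y has_vector_derivative Y t ** (- A t)) (at t within {t0..})"
proof -
  obtain W where W0: "W t0 = Y t0"
    and W: "\<And>t. t \<ge> t0 \<Longrightarrow> (W has_vector_derivative W t ** (- A t)) (at t within {t0..})"
    using linear_ode_solution_exists[OF bounded_bilinear.flip[OF bounded_bilinear_matrix_mult]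
        continuous_on_minus[OF continuous_A]] by blast
  have "W t ** X t = mat 1" if "t \<ge> t0" for t
    using adjoint_solution_mult_constant[of t0 X A W t] X_deriv W W0 YX[of t0] that by simp
  then have "Y s = W s" if "s \<in> {t0..}" for s
    using that matrix_inv_equality unfolding Y_def by auto
  then show ?thesis
    using has_vector_derivative_transform[OF _ _ W[OF t], of Y] t by simp
qed

lemma continuous_on_X: "continuous_on {t0..} X"
  using X_deriv has_vector_derivative_continuous
  unfolding continuous_on_eq_continuous_within by fastforce

lemma continuous_on_Y: "continuous_on {t0..} Y"
  using Y_deriv has_vector_derivative_continuous
  unfolding continuous_on_eq_continuous_within by fastforce

lemma is_solution_X:
  assumes "s \<ge> t0"
  shows "is_solution A s (\<lambda>t. X t *v c)"
  unfolding is_solution_def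
proof (intro allI impI)
  fix t assume "t \<ge> s"
  then have "(X has_vector_derivative A t ** X t) (at t within {s..})"
    using assms by (intro has_vector_derivative_within_subset[OF X_deriv]) auto
  from bounded_linear.has_vector_derivative[OF
      bounded_bilinear.bounded_linear_left[OF bounded_bilinear_matrix_vector_mult] this]
  show "((\<lambda>t. X t *v c) has_vector_derivative A t *v (X t *v c)) (at t within {s..})"
    by (simp add: matrix_vector_mul_assoc)
qed

text \<open>Variation of constants: \<open>Y t *v x t\<close> has derivative zero. This is also the
  uniqueness statement for the initial value problem at \<open>s\<close>.\<close>

lemma is_solution_eq:
  assumes s: "s \<ge> t0" and x: "is_solution A s x" and t: "t \<ge> s"
  shows "x t = X t *v (Y s *v x s)"
proof -
  have "((\<lambda>t. Y t *v x t) has_vector_derivative 0) (at t within {s..})" if "t \<in> {s..}" for t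
  proof -
    have "((\<lambda>t. Y t *v x t) has_vector_derivative
        Y t *v (A t *v x t) + Y t ** (- A t) *v x t) (at t within {s..})"
      using that s x unfolding is_solution_def
      by (intro has_vector_derivative_matrix_vector_mult has_vector_derivative_within_subset[OF Y_deriv]) auto
    moreover have "Y t *v (A t *v x t) + Y t ** (- A t) *v x t = 0"
      by (simp add: matrix_vector_mul_assoc bounded_bilinear.minus_left[OF bounded_bilinear_matrix_vector_mult]
          bounded_bilinear.minus_right[OF bounded_bilinear_matrix_mult])
    ultimately show ?thesis by metis
  qed
  then obtain c where c: "\<And>t. t \<in> {s..} \<Longrightarrow> Y t *v x t = c"
    using has_vector_derivative_zero_constant[of "{s..}" "\<lambda>t. Y t *v x t"] by (metis convex_real_interval(1))
  have "Y t *v x t = Y s *v x s" using c[of t] c[of s] t by simp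
  then show ?thesis using XYv[of t] s t by (metis order_trans)
qed

end

subsection \<open>The Lyapunov matrix of a uniformly asymptotically stable system\<close>

lemma inner_transpose_matrix:
  fixes M :: "real^'n^'m"
  shows "v \<bullet> (transpose M *v w) = (M *v v) \<bullet> w"
  by (simp add: dot_lmul_matrix inner_commute[of v] inner_commute[of w])

lemma inner_gram: "v \<bullet> ((transpose M ** M) *v v) = (norm (M *v v))\<^sup>2" for M :: "real^'n^'m"
  by (simp add: inner_transpose_matrix power2_norm_eq_inner flip: matrix_vector_mul_assoc
      del: transpose_matrix_vector)

text \<open>Entries of M^T M are inner products of columns, and each column is the image of a unit
  vector, so every entry is at most \<open>b\<^sup>2\<close> in absolute value. The dimension
  factors are crude, but the estimate only serves to establish integrability.\<close>

lemma norm_gram_le: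
  fixes M :: "real^'n^'m"
  assumes M: "\<And>v. norm (M *v v) \<le> b * norm v"
  shows "norm (transpose M ** M) \<le> real CARD('n) * (real CARD('n) * b\<^sup>2)"
proof -
  have col: "norm (column i M) \<le> b" for i
    using M[of "axis i 1"] by (simp add: matrix_vector_mult_basis)
  have entry: "\<bar>(transpose M ** M) $ i $ j\<bar> \<le> b\<^sup>2" for i j
  proof -
    have "\<bar>column i M \<bullet> column j M\<bar> \<le> norm (column i M) * norm (column j M)"
      by (rule Cauchy_Schwarz_ineq2)
    also have "\<dots> \<le> b * b"
      using col by (intro mult_mono) (auto intro: order_trans[OF norm_ge_zero])
    finally show ?thesis by (simp add: matrix_mult_transpose_dot_column power2_eq_square)
  qed
  have row: "norm ((transpose M ** M) $ i) \<le> real CARD('n) * b\<^sup>2" for i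
    using order_trans[OF norm_le_l1_cart[of "(transpose M ** M) $ i"]
        sum_bounded_above[of UNIV "\<lambda>j. \<bar>(transpose M ** M) $ i $ j\<bar>" "b\<^sup>2"]] entry by simp
  have "norm (transpose M ** M) \<le> (\<Sum>i\<in>UNIV. norm ((transpose M ** M) $ i))"
    unfolding norm_vec_def[of "transpose M ** M"] by (rule L2_set_le_sum) simp
  also have "\<dots> \<le> real CARD('n) * (real CARD('n) * b\<^sup>2)"
    using sum_bounded_above[of UNIV "\<lambda>i. norm ((transpose M ** M) $ i)", OF row] by simp
  finally show ?thesis .
qed

lemma integrable_on_exp_dominated:
  fixes f :: "real \<Rightarrow> 'b::euclidean_space"
  assumes f: "continuous_on {c..} f" and a: "a > 0"
    and le: "\<And>x. x \<ge> c \<Longrightarrow> norm (f x) \<le> C * exp (- a * x)"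
  shows "f integrable_on {c..}"
proof (rule measurable_bounded_by_integrable_imp_integrable)
  show "f \<in> borel_measurable (lebesgue_on {c..})"
    by (rule continuous_imp_measurable_on_sets_lebesgue[OF f]) auto
  show "(\<lambda>x. C * exp (- a * x)) integrable_on {c..}"
    using integrable_on_cmult_left[OF integrable_on_exp_minus_to_infinity[OF a]] by simp
qed (use le in auto)

text \<open>Translation on compact boxes is carried over to the whole line through the definition of
  the integral by large boxes.\<close>

lemma has_integral_shift_UNIV:
  fixes f :: "real \<Rightarrow> 'b::banach"
  assumes f: "(f has_integral I) UNIV"
  shows "((\<lambda>x. f (x + c)) has_integral I) UNIV"
  unfolding has_integral'[of _ _ UNIV]
proof (intro allI impI)
  fix e :: real assume "e > 0"
  then obtain B where B: "B > 0" "\<And>a b. ball 0 B \<subseteq> cbox a b \<Longrightarrow>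
      \<exists>z. ((\<lambda>x. if x \<in> UNIV then f x else 0) has_integral z) (cbox a b) \<and> norm (z - I) < e"
    using f unfolding has_integral'[of _ _ UNIV] by blast
  show "\<exists>B>0. \<forall>a b. ball 0 B \<subseteq> cbox a b \<longrightarrow>
      (\<exists>z. ((\<lambda>x. if x \<in> UNIV then f (x + c) else 0) has_integral z) (cbox a b) \<and> norm (z - I) < e)"
  \<comment> \<open>Enlarging the radius by \<open>\<bar>c\<bar>\<close> makes the translated box
    still contain the ball of radius \<open>B\<close>.\<close>
  proof (intro exI[of _ "B + \<bar>c\<bar>"] conjI allI impI)
    show "B + \<bar>c\<bar> > 0" using B(1) by linarith
    fix a b :: real assume ab: "ball 0 (B + \<bar>c\<bar>) \<subseteq> cbox a b"
    have "ball 0 B \<subseteq> cbox (a + c) (b + c)"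
    proof
      fix y :: real assume "y \<in> ball 0 B"
      then have "y - c \<in> ball 0 (B + \<bar>c\<bar>)" by auto
      then have "y - c \<in> cbox a b" using ab by blast
      then show "y \<in> cbox (a + c) (b + c)" by auto
    qed
    from B(2)[OF this] obtain z where z: "(f has_integral z) (cbox (a + c) (b + c))" "norm (z - I) < e"
      by auto
    then show "\<exists>z. ((\<lambda>x. if x \<in> UNIV then f (x + c) else 0) has_integral z) (cbox a b) \<and> norm (z - I) < e"
      using has_integral_affinity'[OF z(1), of 1 c] by auto
  qed
qed

lemma has_integral_shift_atLeast:
  fixes f :: "real \<Rightarrow> 'b::banach"
  assumes "(f has_integral I) {c..}"
  shows "((\<lambda>x. f (x + c)) has_integral I) {0..}"
proof -
  have "((\<lambda>x. if x \<in> {c..} then f x else 0) has_integral I) UNIV"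
    using assms by (simp only: has_integral_restrict_UNIV)
  from has_integral_shift_UNIV[OF this, of c]
  have "((\<lambda>x. if x \<in> {0..} then f (x + c) else 0) has_integral I) UNIV" by simp
  then show ?thesis by (simp only: has_integral_restrict_UNIV)
qed

section \<open>Differential inequalities\<close>

lemma nonpos_derivative_imp_nonincreasing:
  fixes f :: "real \<Rightarrow> real"
  assumes f: "\<And>t. t \<ge> t0 \<Longrightarrow> (f has_real_derivative d t) (at t within {t0..})"
    and d: "\<And>t. t \<ge> t0 \<Longrightarrow> d t \<le> 0" and "t0 \<le> a" "a \<le> b"
  shows "f b \<le> f a"
proof (cases "a = b")
  case False
  then have "a < b" using assms by auto
  moreover have "(f has_derivative (*) (d x)) (at x within {a..b})" if "a \<le> x" "x \<le> b" for x
    using DERIV_subset[OF f[of x], of "{a..b}"] that \<open>t0 \<le> a\<close>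
    unfolding has_field_derivative_def by (simp add: subset_iff)
  ultimately obtain x where x: "x \<in> {a<..<b}" "f b - f a = d x * (b - a)"
    using mvt_simple[of a b f "\<lambda>x. (*) (d x)"] by blast
  moreover have "d x * (b - a) \<le> 0"
    using d[of x] \<open>a < b\<close> \<open>t0 \<le> a\<close> x(1) by (intro mult_nonpos_nonneg) auto
  ultimately show ?thesis by linarith
qed simp

lemma integral_has_real_derivative_atLeast:
  fixes q :: "real \<Rightarrow> real"
  assumes q: "continuous_on {t0..} q" and t: "t \<ge> t0"
  shows "((\<lambda>t. integral {t0..t} q) has_real_derivative q t) (at t within {t0..})"
proof -
  have "((\<lambda>u. integral {t0..u} q) has_real_derivative q t) (at t within {t0..t+1})"
    by (rule integral_has_real_derivative[OF continuous_on_subset[OF q]]) (use t in auto)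
  moreover have "at t within {t0..t+1} = at t within {t0..}"
    by (rule at_within_nhd[of t "{..<t+1}"]) auto
  ultimately show ?thesis by simp
qed

text \<open>The product of \<open>g\<close> with the integrating factor exp of the integral of
  \<open>q\<close> has nonpositive derivative. The sign of \<open>g\<close> is left free, so that
  the lemma applies to a Lyapunov function for an upper bound and to its negative for a lower
  bound.\<close>

lemma differential_gronwall:
  fixes g q :: "real \<Rightarrow> real"
  assumes g: "\<And>t. t \<ge> t0 \<Longrightarrow> (g has_real_derivative d t) (at t within {t0..})"
    and q: "continuous_on {t0..} q"
    and d: "\<And>t. t \<ge> t0 \<Longrightarrow> d t \<le> - q t * g t" and t: "t \<ge> t0"
  shows "g t \<le> g t0 * exp (- integral {t0..t} q)"
proof -
  let ?p = "\<lambda>t. integral {t0..t} q"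
  have "g t * exp (?p t) \<le> g t0 * exp (?p t0)"
  proof (rule nonpos_derivative_imp_nonincreasing[where f = "\<lambda>t. g t * exp (?p t)"])
    fix t assume t: "t \<ge> t0"
    have e: "((\<lambda>t. exp (?p t)) has_real_derivative exp (?p t) * q t) (at t within {t0..})"
      by (rule DERIV_chain2[OF DERIV_exp integral_has_real_derivative_atLeast[OF q t]])
    show "((\<lambda>t. g t * exp (?p t)) has_real_derivative
        d t * exp (?p t) + exp (?p t) * q t * g t) (at t within {t0..})"
      by (rule DERIV_mult[OF g[OF t] e])
    have "(d t + q t * g t) * exp (?p t) \<le> 0"
      using d[OF t] by (intro mult_nonpos_nonneg) auto
    then show "d t * exp (?p t) + exp (?p t) * q t * g t \<le> 0"
      by (simp add: algebra_simps)
  qed (use t in auto)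
  then have "g t * exp (?p t) * exp (- ?p t) \<le> g t0 * exp (- ?p t)"
    by (intro mult_right_mono) auto
  then show ?thesis by (simp add: mult.assoc flip: exp_add)
qed

section \<open>The matrix \<open>H\<close> and its Lyapunov function\<close>

locale uas_system = fundamental_system A t0 X Y
  for A :: "real \<Rightarrow> real^'n^'n" and t0 X Y +
  fixes gam lam :: real
  assumes lam: "lam > 0"
    and decay: "\<And>t s v. t0 \<le> s \<Longrightarrow> s \<le> t \<Longrightarrow>
      norm (X t *v (Y s *v v)) \<le> gam * exp (- lam * (t - s)) * norm v"
begin

definition gram :: "real \<Rightarrow> real^'n^'n" where
  "gram \<tau> = transpose (X \<tau>) ** X \<tau>"

definition G :: "real \<Rightarrow> real^'n^'n" where
  "G t = integral {t..} gram"

text \<open>The factors depending on \<open>t\<close> are taken out of the integral of the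
  transition matrices. What remains, \<open>G\<close>, depends on \<open>t\<close> only through the
  limit of integration and is easy to differentiate.\<close>

definition H :: "real \<Rightarrow> real^'n^'n" where
  "H t = transpose (Y t) ** (G t ** Y t)"

lemma continuous_on_gram: "continuous_on {t0..} gram"
  unfolding gram_def
  by (intro bounded_bilinear.continuous_on[OF bounded_bilinear_matrix_mult] continuous_on_X
      bounded_linear.continuous_on[OF bounded_linear_transpose])

text \<open>Decay of \<open>X\<close> at rate \<open>lam\<close> makes the Gram matrix decay at rate
  \<open>2 * lam\<close>, so an exponential dominates it.\<close>

lemma gram_integrable:
  assumes "t \<ge> t0"
  shows "gram integrable_on {t..}"
proof (rule integrable_on_exp_dominated)
  show "continuous_on {t..} gram"
    by (rule continuous_on_subset[OF continuous_on_gram]) (use assms in auto)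
  show "0 < 2 * lam" using lam by simp
  \<comment> \<open>From X(x) = X(x) Y(t0) X(t0): the decay from \<open>t0\<close> on, with
    \<open>exp (lam * t0)\<close> absorbing the shift of the exponent and \<open>onorm\<close>
    bounding X(t0). The absolute value is taken because the sign of \<open>gam\<close> is not
    prescribed.\<close>
  define K where "K = \<bar>gam\<bar> * exp (lam * t0) * onorm ((*v) (X t0))"
  fix x assume "x \<ge> t"
  then have x: "x \<ge> t0" using assms by simp
  have X0: "norm (X t0 *v v) \<le> onorm ((*v) (X t0)) * norm v" for v
    by (rule onorm) simp
  have "norm (X x *v v) \<le> (K * exp (- lam * x)) * norm v" for v
  proof -
    have "norm (X x *v v) = norm (X x *v (Y t0 *v (X t0 *v v)))" by (simp add: YXv)
    also have "\<dots> \<le> gam * exp (- lam * (x - t0)) * norm (X t0 *v v)"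
      by (rule decay) (use x in auto)
    also have "\<dots> \<le> \<bar>gam\<bar> * exp (- lam * (x - t0)) * (onorm ((*v) (X t0)) * norm v)"
      by (intro mult_mono X0) auto
    also have "exp (- lam * (x - t0)) = exp (lam * t0) * exp (- lam * x)"
      by (simp add: algebra_simps flip: exp_add)
    finally show ?thesis unfolding K_def by (simp add: mult_ac)
  qed
  from norm_gram_le[OF this]
  have "norm (gram x) \<le> real CARD('n) * (real CARD('n) * (K * exp (- lam * x))\<^sup>2)"
    unfolding gram_def .
  also have "(K * exp (- lam * x))\<^sup>2 = K\<^sup>2 * exp (- (2 * lam) * x)"
    by (simp add: power_mult_distrib algebra_simps flip: exp_double)
  finally show "norm (gram x) \<le> real CARD('n) * (real CARD('n) * K\<^sup>2) * exp (- (2 * lam) * x)"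
    by (simp add: mult_ac)
qed

lemma gram_has_integral: "t \<ge> t0 \<Longrightarrow> (gram has_integral G t) {t..}"
  unfolding G_def using gram_integrable integrable_integral by blast

text \<open>Splitting the half-line at \<open>t\<close> turns the moving lower limit of an improper
  integral into the upper limit of a proper one, to which the fundamental theorem of calculus
  applies.\<close>

lemma G_eq:
  assumes t: "t \<ge> t0"
  shows "G t = G t0 - integral {t0..t} gram"
proof -
  have "gram integrable_on {t0..t}"
    by (intro integrable_continuous_interval continuous_on_subset[OF continuous_on_gram]) auto
  then have "(gram has_integral integral {t0..t} gram + G t) ({t0..t} \<union> {t..})"
    using t by (intro has_integral_Un gram_has_integral integrable_integral) auto
  moreover have "{t0..t} \<union> {t..} = {t0..}" using t by auto
  ultimately have "(gram has_integral integral {t0..t} gram + G t) {t0..}" by simp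
  then have "G t0 = integral {t0..t} gram + G t"
    using has_integral_unique gram_has_integral[of t0] by blast
  then show ?thesis by simp
qed

lemma G_deriv:
  assumes t: "t \<ge> t0"
  shows "(G has_vector_derivative - gram t) (at t within {t0..})"
proof -
  have "((\<lambda>u. integral {t0..u} gram) has_vector_derivative gram t) (at t within {t0..t+1})"
    by (rule integral_has_vector_derivative[OF continuous_on_subset[OF continuous_on_gram]])
       (use t in auto)
  moreover have "at t within {t0..t+1} = at t within {t0..}"
    by (rule at_within_nhd[of t "{..<t+1}"]) auto
  ultimately have "((\<lambda>u. G t0 - integral {t0..u} gram) has_vector_derivative 0 - gram t) (at t within {t0..})"
    by (intro has_vector_derivative_diff has_vector_derivative_const) simp
  then have "(G has_vector_derivative 0 - gram t) (at t within {t0..})"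
    by (rule has_vector_derivative_transform[rotated 2]) (use t in \<open>auto intro: G_eq\<close>)
  then show ?thesis by simp
qed

lemma continuous_on_G: "continuous_on {t0..} G"
  unfolding continuous_on_eq_continuous_within
  using has_vector_derivative_continuous[OF G_deriv] by auto

lemma continuous_on_H: "continuous_on {t0..} H"
  unfolding H_def
  by (intro bounded_bilinear.continuous_on[OF bounded_bilinear_matrix_mult] continuous_on_Y continuous_on_G
      bounded_linear.continuous_on[OF bounded_linear_transpose])

text \<open>Multiplication by the fixed factors \<open>transpose (Y t)\<close> and
  \<open>Y t\<close> is bounded linear and so passes under the integral, which restores the
  integrand built from the transition matrix.\<close>

lemma H_has_integral:
  assumes t: "t \<ge> t0"
  shows "((\<lambda>\<tau>. transpose (X \<tau> ** Y t) ** (X \<tau> ** Y t)) has_integral H t) {t..}"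
proof -
  have "bounded_linear (\<lambda>M. transpose (Y t) ** (M ** Y t))"
    by (rule bounded_linear_compose[OF
          bounded_bilinear.bounded_linear_right[OF bounded_bilinear_matrix_mult]
          bounded_bilinear.bounded_linear_left[OF bounded_bilinear_matrix_mult]])
  from has_integral_linear[OF gram_has_integral[OF t] this] show ?thesis
    by (simp add: H_def o_def gram_def matrix_transpose_mul matrix_mul_assoc)
qed

lemma symmetric_H:
  assumes t: "t \<ge> t0"
  shows "symmetric_matrix (H t)"
proof -
  have "(transpose \<circ> (\<lambda>\<tau>. transpose (X \<tau> ** Y t) ** (X \<tau> ** Y t)) has_integral transpose (H t)) {t..}"
    by (rule has_integral_linear[OF H_has_integral[OF t] bounded_linear_transpose])
  then have "((\<lambda>\<tau>. transpose (X \<tau> ** Y t) ** (X \<tau> ** Y t)) has_integral transpose (H t)) {t..}"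
    by (simp add: o_def matrix_transpose_mul)
  then show ?thesis
    unfolding symmetric_matrix_def using H_has_integral[OF t] by (rule has_integral_unique)
qed

lemma inner_H_has_integral:
  assumes t: "t \<ge> t0"
  shows "((\<lambda>\<tau>. (norm (X \<tau> *v (Y t *v v)))\<^sup>2) has_integral v \<bullet> (H t *v v)) {t..}"
proof -
  have "bounded_linear (\<lambda>M. v \<bullet> (M *v v))"
    by (intro bounded_linear_compose[OF bounded_linear_inner_right]
        bounded_bilinear.bounded_linear_left[OF bounded_bilinear_matrix_vector_mult])
  from has_integral_linear[OF H_has_integral[OF t] this] show ?thesis
    by (simp add: o_def inner_gram matrix_vector_mul_assoc)
qed

lemma inner_H: "v \<bullet> (H t *v v) = (Y t *v v) \<bullet> (G t *v (Y t *v v))"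
  unfolding H_def matrix_vector_mul_assoc[symmetric] inner_transpose_matrix ..

lemma inner_G: "t \<ge> t0 \<Longrightarrow> c \<bullet> (G t *v c) = (X t *v c) \<bullet> (H t *v (X t *v c))"
  by (simp add: inner_H YXv)

text \<open>This is the Lyapunov identity: along the solution X c the function V equals c^T G c with
  \<open>c\<close> constant, so its derivative is read off from that of \<open>G\<close> and no
  derivative of \<open>H\<close> is computed.\<close>

lemma inner_G_deriv:
  assumes t: "t \<ge> t0"
  shows "((\<lambda>t. c \<bullet> (G t *v c)) has_real_derivative - (norm (X t *v c))\<^sup>2) (at t within {t0..})"
proof -
  have "bounded_linear (\<lambda>M. c \<bullet> (M *v c))"
    by (intro bounded_linear_compose[OF bounded_linear_inner_right]
        bounded_bilinear.bounded_linear_left[OF bounded_bilinear_matrix_vector_mult])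
  from bounded_linear.has_vector_derivative[OF this G_deriv[OF t]] show ?thesis
    by (simp add: gram_def inner_gram bounded_bilinear.minus_left[OF bounded_bilinear_matrix_vector_mult]
        has_real_derivative_iff_has_vector_derivative)
qed

lemma inner_H_nonneg: "t \<ge> t0 \<Longrightarrow> 0 \<le> v \<bullet> (H t *v v)"
  by (rule has_integral_nonneg[OF inner_H_has_integral]) auto

lemma X_nonzero: "t \<ge> t0 \<Longrightarrow> c \<noteq> 0 \<Longrightarrow> X t *v c \<noteq> 0"
  using YXv[of t c] by auto

text \<open>Strictness comes from the mean value theorem: along the solution through
  \<open>v\<close> the Lyapunov function drops by a positive amount over one unit of time, and it is
  still nonnegative afterwards.\<close>

lemma positive_definite_H:
  assumes t: "t \<ge> t0"
  shows "positive_definite (H t)"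
  unfolding positive_definite_def
proof (intro allI impI)
  fix v :: "real^'n" assume v: "v \<noteq> 0"
  define c where "c = Y t *v v"
  have c: "X t *v c = v" using XYv[OF t] c_def by simp
  have "c \<noteq> 0" using c v by auto
  have "((\<lambda>t. c \<bullet> (G t *v c)) has_derivative (*) (- (norm (X x *v c))\<^sup>2)) (at x within {t..t+1})"
    if "t \<le> x" "x \<le> t + 1" for x
    using DERIV_subset[OF inner_G_deriv[of x c], of "{t..t+1}"] that t
    unfolding has_field_derivative_def by (simp add: subset_iff)
  then obtain x where x: "x \<in> {t<..<t+1}"
    "c \<bullet> (G (t+1) *v c) - c \<bullet> (G t *v c) = - (norm (X x *v c))\<^sup>2 * (t + 1 - t)"
    using mvt_simple[of t "t+1" "\<lambda>t. c \<bullet> (G t *v c)" "\<lambda>x. (*) (- (norm (X x *v c))\<^sup>2)"] by auto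
  have "(norm (X x *v c))\<^sup>2 > 0"
    using X_nonzero[of x c] \<open>c \<noteq> 0\<close> x(1) t by simp
  moreover have "0 \<le> c \<bullet> (G (t+1) *v c)"
    using inner_G[of "t+1" c] inner_H_nonneg[of "t+1"] t by simp
  moreover have "c \<bullet> (G (t+1) *v c) - c \<bullet> (G t *v c) = - (norm (X x *v c))\<^sup>2" using x(2) by simp
  ultimately have "0 < c \<bullet> (G t *v c)" by linarith
  then show "0 < v \<bullet> (H t *v v)" using inner_G[OF t, of c] c by simp
qed

lemma lambda_H_pos: "t \<ge> t0 \<Longrightarrow> 0 < lambda_min (H t)" "t \<ge> t0 \<Longrightarrow> 0 < lambda_max (H t)"
  using lambda_min_pos symmetric_H positive_definite_H lambda_min_le_lambda_max
  by (blast, meson less_le_trans lambda_min_pos symmetric_H positive_definite_H lambda_min_le_lambda_max)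

section \<open>Exponential estimates for solutions\<close>

lemma solution_bounds:
  assumes x: "is_solution A t0 x" and t: "t \<ge> t0"
  shows "sqrt (lambda_min (H t0) / lambda_max (H t)) * norm (x t0) *
      exp (- (1/2) * integral {t0..t} (\<lambda>\<tau>. 1 / lambda_min (H \<tau>))) \<le> norm (x t)"
    and "norm (x t) \<le> sqrt (lambda_max (H t0) / lambda_min (H t)) * norm (x t0) *
      exp (- (1/2) * integral {t0..t} (\<lambda>\<tau>. 1 / lambda_max (H \<tau>)))"
proof -
  define c where "c = Y t0 *v x t0"
  have xc: "x s = X s *v c" if "s \<ge> t0" for s
    using is_solution_eq[OF _ x that] c_def by simp
  define g where "g s = c \<bullet> (G s *v c)" for s
  have g: "g s = x s \<bullet> (H s *v x s)" if "s \<ge> t0" for s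
    using inner_G[OF that] xc[OF that] g_def by simp
  have gd: "(g has_real_derivative - (norm (x s))\<^sup>2) (at s within {t0..})" if "s \<ge> t0" for s
    using inner_G_deriv[OF that, of c] xc[OF that] unfolding g_def by simp
  have gmin: "lambda_min (H s) * (norm (x s))\<^sup>2 \<le> g s" if "s \<ge> t0" for s
    using lambda_min_le_inner[OF symmetric_H[OF that], of "x s"] g[OF that]
    by (simp add: power2_norm_eq_inner)
  have gmax: "g s \<le> lambda_max (H s) * (norm (x s))\<^sup>2" if "s \<ge> t0" for s
    using inner_le_lambda_max[OF symmetric_H[OF that], of "x s"] g[OF that]
    by (simp add: power2_norm_eq_inner)
  let ?pmin = "integral {t0..t} (\<lambda>\<tau>. 1 / lambda_min (H \<tau>))"
  let ?pmax = "integral {t0..t} (\<lambda>\<tau>. 1 / lambda_max (H \<tau>))"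
  have cmax: "continuous_on {t0..} (\<lambda>\<tau>. 1 / lambda_max (H \<tau>))"
    using lambda_H_pos(2) symmetric_H
    by (intro continuous_intros continuous_on_lambda_max continuous_on_H) fastforce+
  have cmin: "continuous_on {t0..} (\<lambda>\<tau>. 1 / lambda_min (H \<tau>))"
    using lambda_H_pos(1) symmetric_H
    by (intro continuous_intros continuous_on_lambda_min continuous_on_H) fastforce+
  have up: "g t \<le> g t0 * exp (- ?pmax)"
  proof (rule differential_gronwall[OF gd cmax _ t])
    fix s assume s: "s \<ge> t0"
    show "- (norm (x s))\<^sup>2 \<le> - (1 / lambda_max (H s)) * g s"
      using gmax[OF s] lambda_H_pos(2)[OF s] by (simp add: divide_le_eq mult.commute)
  qed
  \<comment> \<open>A lower bound for \<open>g\<close> is obtained by applying the Gronwall argument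
    to \<open>- g\<close>, with the rate given by the smallest eigenvalue.\<close>
  have low: "- g t \<le> - g t0 * exp (- ?pmin)"
  proof (rule differential_gronwall[OF DERIV_minus[OF gd] cmin _ t])
    fix s assume s: "s \<ge> t0"
    show "- (- (norm (x s))\<^sup>2) \<le> - (1 / lambda_min (H s)) * (- g s)"
      using gmin[OF s] lambda_H_pos(1)[OF s] by (simp add: le_divide_eq mult.commute)
  qed
  \<comment> \<open>The factor 1/2 in the exponents arises because the estimates are first proved
    for the squared norm.\<close>
  have half: "exp (- (1/2) * p) = sqrt (exp (- p))" for p :: real
    by (rule real_sqrt_unique[symmetric]) (simp_all flip: exp_double)
  note pos = lambda_H_pos[OF t] lambda_H_pos[OF order_refl]
  \<comment> \<open>The Rayleigh bounds enter once at \<open>t0\<close> and once at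
    \<open>t\<close>, so the quotient pairs an eigenvalue of \<open>H t0\<close> with one of
    \<open>H t\<close>.\<close>
  have "(norm (x t))\<^sup>2 \<le> lambda_max (H t0) / lambda_min (H t) * (norm (x t0))\<^sup>2 * exp (- ?pmax)"
  proof -
    have "lambda_min (H t) * (norm (x t))\<^sup>2 \<le> lambda_max (H t0) * (norm (x t0))\<^sup>2 * exp (- ?pmax)"
    proof -
      have "g t0 * exp (- ?pmax) \<le> lambda_max (H t0) * (norm (x t0))\<^sup>2 * exp (- ?pmax)"
        using gmax[OF order_refl] by (rule mult_right_mono) simp
      then show ?thesis using gmin[OF t] up by linarith
    qed
    then show ?thesis using pos by (simp add: field_simps)
  qed
  then have "sqrt ((norm (x t))\<^sup>2) \<le> sqrt (lambda_max (H t0) / lambda_min (H t) * (norm (x t0))\<^sup>2 * exp (- ?pmax))"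
    by (rule real_sqrt_le_mono)
  then show "norm (x t) \<le> sqrt (lambda_max (H t0) / lambda_min (H t)) * norm (x t0) *
      exp (- (1/2) * ?pmax)"
    unfolding half by (simp only: real_sqrt_mult real_sqrt_abs abs_norm_cancel)
  have "lambda_min (H t0) / lambda_max (H t) * (norm (x t0))\<^sup>2 * exp (- ?pmin) \<le> (norm (x t))\<^sup>2"
  proof -
    have "lambda_min (H t0) * (norm (x t0))\<^sup>2 * exp (- ?pmin) \<le> lambda_max (H t) * (norm (x t))\<^sup>2"
    proof -
      have "lambda_min (H t0) * (norm (x t0))\<^sup>2 * exp (- ?pmin) \<le> g t0 * exp (- ?pmin)"
        using gmin[OF order_refl] by (rule mult_right_mono) simp
      then show ?thesis using gmax[OF t] low by linarith
    qed
    then show ?thesis using pos by (simp add: field_simps)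
  qed
  then have "sqrt (lambda_min (H t0) / lambda_max (H t) * (norm (x t0))\<^sup>2 * exp (- ?pmin)) \<le> sqrt ((norm (x t))\<^sup>2)"
    by (rule real_sqrt_le_mono)
  then show "sqrt (lambda_min (H t0) / lambda_max (H t)) * norm (x t0) *
      exp (- (1/2) * ?pmin) \<le> norm (x t)"
    unfolding half by (simp only: real_sqrt_mult real_sqrt_abs abs_norm_cancel)
qed

text \<open>Squaring the decay bound and integrating exp (- 2 b (\<tau> - t)) over
  \<open>{t..}\<close> gives the factor 1 / (2 b). The constants \<open>a\<close> and
  \<open>b\<close> are separate from \<open>gam\<close> and \<open>lam\<close>, so any admissible
  pair may be used.\<close>

lemma lambda_max_H_le:
  assumes b: "b > 0"
    and le: "\<And>\<tau> v. \<tau> \<ge> t \<Longrightarrow> norm (X \<tau> *v (Y t *v v)) \<le> a * exp (- b * (\<tau> - t)) * norm v"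
    and t: "t \<ge> t0"
  shows "lambda_max (H t) \<le> a\<^sup>2 / (2 * b)"
proof (rule eigenvalue_le[OF lambda_max_eigenvalue[OF symmetric_H[OF t]]])
  fix v :: "real^'n"
  have "((\<lambda>\<tau>. exp (- (2 * b) * \<tau>)) has_integral exp (- (2 * b) * t) / (2 * b)) {t..}"
    using b by (intro has_integral_exp_minus_to_infinity) simp
  from has_integral_mult_right[OF this, of "a\<^sup>2 * exp (2 * b * t) * (v \<bullet> v)"]
  have "((\<lambda>\<tau>. a\<^sup>2 * exp (2 * b * t) * (v \<bullet> v) * exp (- (2 * b) * \<tau>)) has_integral
      a\<^sup>2 / (2 * b) * (v \<bullet> v)) {t..}"
    by (simp add: exp_minus field_simps)
  then show "v \<bullet> (H t *v v) \<le> a\<^sup>2 / (2 * b) * (v \<bullet> v)"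
  proof (rule has_integral_le[OF inner_H_has_integral[OF t]])
    fix \<tau> assume "\<tau> \<in> {t..}"
    then have "(norm (X \<tau> *v (Y t *v v)))\<^sup>2 \<le> (a * exp (- b * (\<tau> - t)) * norm v)\<^sup>2"
      using le by (intro power_mono) auto
    also have "\<dots> = a\<^sup>2 * exp (2 * (- b * (\<tau> - t))) * (v \<bullet> v)"
      by (simp only: power_mult_distrib exp_double power2_norm_eq_inner)
    also have "2 * (- b * (\<tau> - t)) = 2 * b * t + - (2 * b) * \<tau>" by (simp add: algebra_simps)
    finally show "(norm (X \<tau> *v (Y t *v v)))\<^sup>2 \<le> a\<^sup>2 * exp (2 * b * t) * (v \<bullet> v) * exp (- (2 * b) * \<tau>)"
      unfolding exp_add by (simp only: mult_ac)
  qed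
qed

text \<open>Along a solution \<open>X c\<close> the quantity \<open>k = 2 L V - |X c|\<^sup>2\<close> is nonincreasing and bounded
  below by \<open>- |X c|\<^sup>2\<close>, which tends to \<open>0\<close>. The case \<open>L = 0\<close> is separated only because \<open>1 / 0 = 0\<close>.\<close>

lemma lambda_min_H_ge:
  assumes L: "\<And>t. t \<ge> t0 \<Longrightarrow> spectral_norm (A t) \<le> L" and t: "t \<ge> t0"
  shows "1 / (2 * L) \<le> lambda_min (H t)"
proof (cases "L = 0")
  case True
  then show ?thesis using lambda_H_pos(1)[OF t] by simp
next
  case False
  have "0 \<le> spectral_norm (A t)" unfolding spectral_norm_def by (rule onorm_pos_le) simp
  then have L0: "L > 0" using L[OF t] False by linarith
  show ?thesis
  proof (rule le_eigenvalue[OF lambda_min_eigenvalue[OF symmetric_H[OF t]]])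
    fix v :: "real^'n"
    define c where "c = Y t *v v"
    have c: "X t *v c = v" using XYv[OF t] c_def by simp
    define k where "k s = 2 * L * (c \<bullet> (G s *v c)) - (X s *v c) \<bullet> (X s *v c)" for s
    have Xc: "((\<lambda>s. X s *v c) has_vector_derivative A s *v (X s *v c)) (at s within {t0..})" if "s \<ge> t0" for s
      using is_solution_X[of t0 c] that unfolding is_solution_def by simp
    have kd: "(k has_real_derivative 2 * L * - (norm (X s *v c))\<^sup>2 -
        ((X s *v c) \<bullet> (A s *v (X s *v c)) + (A s *v (X s *v c)) \<bullet> (X s *v c))) (at s within {t0..})"
      if "s \<ge> t0" for s
      unfolding k_def
      by (intro DERIV_diff DERIV_cmult inner_G_deriv that
          bounded_bilinear.has_vector_derivative[OF bounded_bilinear_inner Xc[OF that] Xc[OF that],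
            folded has_real_derivative_iff_has_vector_derivative])
    \<comment> \<open>By Cauchy-Schwarz and the bound on the spectral norm, - 2 x^T A x is at most 2
      L |x|^2, which the term coming from 2 L V compensates exactly.\<close>
    have kd0: "2 * L * - (norm (X s *v c))\<^sup>2 -
        ((X s *v c) \<bullet> (A s *v (X s *v c)) + (A s *v (X s *v c)) \<bullet> (X s *v c)) \<le> 0"
      if "s \<ge> t0" for s
    proof -
      let ?x = "X s *v c"
      have "- (?x \<bullet> (A s *v ?x)) \<le> norm ?x * norm (A s *v ?x)"
        using Cauchy_Schwarz_ineq2[of ?x "A s *v ?x"] by linarith
      also have "\<dots> \<le> norm ?x * (L * norm ?x)"
      proof (intro mult_left_mono)
        have "norm (A s *v ?x) \<le> spectral_norm (A s) * norm ?x"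
          unfolding spectral_norm_def by (rule onorm) simp
        also have "\<dots> \<le> L * norm ?x" using L[OF that] by (rule mult_right_mono) simp
        finally show "norm (A s *v ?x) \<le> L * norm ?x" .
      qed simp
      finally have "- (?x \<bullet> (A s *v ?x)) \<le> L * (norm ?x)\<^sup>2"
        by (simp add: power2_eq_square mult_ac)
      then show ?thesis by (simp add: inner_commute[of "A s *v ?x"])
    qed
    have "((\<lambda>s. (norm (X s *v c))\<^sup>2) \<longlongrightarrow> 0) at_top"
    proof (rule Lim_null_comparison)
      show "\<forall>\<^sub>F s in at_top. norm ((norm (X s *v c))\<^sup>2) \<le> (gam * exp (- lam * (s - t)) * norm v)\<^sup>2"
        using eventually_ge_at_top[of t]
      proof eventually_elim
        case (elim s)
        have "(norm (X s *v c))\<^sup>2 \<le> (gam * exp (- lam * (s - t)) * norm v)\<^sup>2"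
          unfolding c_def using decay[OF t elim] by (intro power_mono) auto
        then show ?case by simp
      qed
      have "filterlim (\<lambda>s. - t + s) at_top at_top"
        by (rule filterlim_tendsto_add_at_top[OF tendsto_const filterlim_ident])
      then have "filterlim (\<lambda>s. - lam * (- t + s)) at_bot at_top"
        by (rule filterlim_tendsto_neg_mult_at_bot[OF tendsto_const, rotated]) (use lam in simp)
      then have e: "((\<lambda>s. exp (- lam * (- t + s))) \<longlongrightarrow> 0) at_top"
        by (rule filterlim_compose[OF exp_at_bot])
      have "((\<lambda>s. (gam * exp (- lam * (- t + s)) * norm v)\<^sup>2) \<longlongrightarrow> (gam * 0 * norm v)\<^sup>2) at_top"
        by (intro tendsto_power tendsto_mult e tendsto_const)
      then show "((\<lambda>s. (gam * exp (- lam * (s - t)) * norm v)\<^sup>2) \<longlongrightarrow> 0) at_top"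
        by simp
    qed
    from tendsto_minus[OF this] have "((\<lambda>s. - (norm (X s *v c))\<^sup>2) \<longlongrightarrow> 0) at_top"
      by simp
    then have "0 \<le> k t"
    proof (rule tendsto_upperbound)
      show "\<forall>\<^sub>F s in at_top. - (norm (X s *v c))\<^sup>2 \<le> k t"
        using eventually_ge_at_top[of t]
      proof eventually_elim
        case (elim s)
        have "- (norm (X s *v c))\<^sup>2 \<le> k s"
          using inner_G[of s c] inner_H_nonneg[of s "X s *v c"] elim t L0
          unfolding k_def by (simp add: power2_norm_eq_inner)
        also have "k s \<le> k t"
          by (rule nonpos_derivative_imp_nonincreasing[OF kd kd0 t elim])
        finally show ?case .
      qed
    qed simp
    then show "1 / (2 * L) * (v \<bullet> v) \<le> v \<bullet> (H t *v v)"
      using inner_G[OF t, of c] c L0 unfolding k_def by (simp add: field_simps)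
  qed
qed

end

subsection \<open>Constant coefficients\<close>

lemma mat_power_scaleR: "mat_power (t *\<^sub>R M) k = t ^ k *\<^sub>R mat_power M k"
  by (induction k) (simp_all add: matrix_scalar_ac flip: scalar_matrix_assoc)

lemma mat_power_commute: "mat_power M k ** M = M ** mat_power M k"
  by (induction k) (simp_all flip: matrix_mul_assoc)

text \<open>Transposition reverses the factors; commutation of a matrix with its powers restores
  their order.\<close>

lemma mat_power_transpose: "mat_power (transpose M) k = transpose (mat_power M k)"
  by (induction k) (simp_all add: matrix_transpose_mul flip: mat_power_commute)

text \<open>The terms t^k / k! M^k satisfy the Peano-Baker recursion for the constant coefficient
  \<open>M\<close> on the half-line from \<open>0\<close>, with the identity as initial
  term.\<close>

lemma mat_exp_scaleR_deriv:
  fixes M :: "real^'n^'n"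
  assumes t: "t \<ge> 0"
  shows summable_mat_exp: "summable (\<lambda>k. (t ^ k / fact k) *\<^sub>R mat_power M k)"
    and mat_exp_has_vector_derivative:
      "((\<lambda>t. mat_exp (t *\<^sub>R M)) has_vector_derivative M ** mat_exp (t *\<^sub>R M)) (at t within {0..})"
proof -
  define Z where "Z k t = (t ^ k / fact k) *\<^sub>R mat_power M k" for k and t :: real
  have step: "(Z (Suc k) has_vector_derivative M ** Z k t) (at t within {0..})" for k t
  proof -
    have "((\<lambda>t. t ^ Suc k / fact (Suc k)) has_real_derivative
        real (Suc k) * (1 * t ^ (Suc k - Suc 0)) / fact (Suc k)) (at t within {0..})"
      by (intro DERIV_cdivide DERIV_power DERIV_ident)
    moreover have "real (Suc k) * (1 * t ^ (Suc k - Suc 0)) / fact (Suc k) = t ^ k / fact k"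
      unfolding fact_Suc by (simp del: of_nat_Suc)
    ultimately have "((\<lambda>t. t ^ Suc k / fact (Suc k)) has_vector_derivative t ^ k / fact k) (at t within {0..})"
      by (simp only: has_real_derivative_iff_has_vector_derivative)
    from bounded_linear.has_vector_derivative[OF bounded_linear_scaleR_left this, of "mat_power M (Suc k)"]
    show ?thesis unfolding Z_def by (simp add: matrix_scalar_ac flip: scalar_matrix_assoc)
  qed
  have Z: "mat_exp (t *\<^sub>R M) = (\<Sum>k. Z k t)" for t
    unfolding mat_exp_def Z_def mat_power_scaleR by simp
  note series = peano_baker_series_has_vector_derivative[where Z = Z and B = "\<lambda>_. M" and ?X0.0 = "mat 1",
      OF bounded_bilinear_matrix_mult continuous_on_const _ _ step t]
  show "summable (\<lambda>k. (t ^ k / fact k) *\<^sub>R mat_power M k)"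
    using series(1) unfolding Z_def by simp
  show "((\<lambda>t. mat_exp (t *\<^sub>R M)) has_vector_derivative M ** mat_exp (t *\<^sub>R M)) (at t within {0..})"
    unfolding Z by (rule series(2)) (simp_all add: Z_def)
qed

lemma mat_exp_zero: "mat_exp (0 *\<^sub>R M) = mat 1"
proof -
  have "(\<Sum>k. (1 / fact k) *\<^sub>R mat_power (0 *\<^sub>R M) k) = (\<Sum>k\<in>{0}. (1 / fact k) *\<^sub>R mat_power (0 *\<^sub>R M) k)"
    \<comment> \<open>The product \<open>0 *\<^sub>R M\<close> must stay unsimplified so that
      \<open>mat_power_scaleR\<close> can produce the factor \<open>0 ^ k\<close>, which vanishes
      for positive \<open>k\<close>.\<close>
    by (rule suminf_finite) (auto simp: mat_power_scaleR simp del: scaleR_zero_left)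
  then show ?thesis by (simp add: mat_exp_def)
qed

lemma mat_exp_transpose:
  fixes M :: "real^'n^'n"
  assumes t: "t \<ge> 0"
  shows "mat_exp (t *\<^sub>R transpose M) = transpose (mat_exp (t *\<^sub>R M))"
  using bounded_linear.suminf[OF bounded_linear_transpose summable_mat_exp[OF t, of M]]
  by (simp add: mat_exp_def mat_power_scaleR mat_power_transpose transpose_scalar)

context fundamental_system
begin

text \<open>Applied to any vector, the shifted exponential solves the system from \<open>s\<close>
  on and starts at that vector, so uniqueness of solutions identifies it with the transition
  matrix.\<close>

lemma transition_eq_mat_exp:
  assumes A0: "\<And>t. t \<ge> t0 \<Longrightarrow> A t = A0" and s: "s \<ge> t0" and t: "t \<ge> s"
  shows "X t ** Y s = mat_exp ((t - s) *\<^sub>R A0)"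
proof -
  have "mat_exp ((t - s) *\<^sub>R A0) *v v = X t *v (Y s *v v)" for v
  proof -
    have "is_solution A s (\<lambda>t. mat_exp ((t - s) *\<^sub>R A0) *v v)"
      unfolding is_solution_def
    proof (intro allI impI)
      fix u assume u: "u \<ge> s"
      have "(\<lambda>t. t - s) ` {s..} = {0..}"
        by (auto simp: image_iff intro!: bexI[of _ "_ + s"])
      then have "(((\<lambda>r. mat_exp (r *\<^sub>R A0)) \<circ> (\<lambda>t. t - s)) has_vector_derivative
          1 *\<^sub>R (A0 ** mat_exp ((u - s) *\<^sub>R A0))) (at u within {s..})"
        using u by (intro vector_diff_chain_within)
          (auto intro!: derivative_eq_intros mat_exp_has_vector_derivative)
      then have "((\<lambda>t. mat_exp ((t - s) *\<^sub>R A0)) has_vector_derivative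
          A0 ** mat_exp ((u - s) *\<^sub>R A0)) (at u within {s..})"
        by (simp add: o_def)
      from bounded_linear.has_vector_derivative[OF
          bounded_bilinear.bounded_linear_left[OF bounded_bilinear_matrix_vector_mult] this]
      show "((\<lambda>t. mat_exp ((t - s) *\<^sub>R A0) *v v) has_vector_derivative
          A u *v (mat_exp ((u - s) *\<^sub>R A0) *v v)) (at u within {s..})"
        using A0[of u] u s by (simp add: matrix_vector_mul_assoc)
    qed
    from is_solution_eq[OF s this t] show ?thesis
      using mat_exp_zero[of A0] by simp
  qed
  then show ?thesis
    unfolding matrix_eq by (simp add: matrix_vector_mul_assoc)
qed

end

text \<open>Shifting the integration variable by \<open>t\<close> turns the transition matrix into
  an exponential of the elapsed time alone, so the integral no longer depends on
  \<open>t\<close>.\<close>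

lemma (in uas_system) H_constant:
  assumes A0: "\<And>t. t \<ge> t0 \<Longrightarrow> A t = A0" and t: "t \<ge> t0"
  shows "((\<lambda>\<tau>. mat_exp (\<tau> *\<^sub>R transpose A0) ** mat_exp (\<tau> *\<^sub>R A0)) has_integral H t) {0..}"
proof -
  have "((\<lambda>\<tau>. transpose (X (\<tau> + t) ** Y t) ** (X (\<tau> + t) ** Y t)) has_integral H t) {0..}"
    by (rule has_integral_shift_atLeast[OF H_has_integral[OF t]])
  then show ?thesis
    by (rule has_integral_eq[rotated])
       (use transition_eq_mat_exp[OF A0 t] in \<open>simp add: mat_exp_transpose\<close>)
qed

section \<open>Transition matrix, stability constants and conclusion\<close>

theorem theorem4:
  fixes A :: "real \<Rightarrow> real^'n^'n" and t0 :: real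
  assumes "continuous_on {t0..} A"
    and "uniformly_asymptotically_stable A t0"
  shows "\<exists>H :: real \<Rightarrow> real^'n^'n.
     continuous_on {t0..} H \<and>
     (\<forall>t\<ge>t0. symmetric_matrix (H t) \<and> positive_definite (H t)) \<and>
     (\<forall>t\<ge>t0. ((\<lambda>\<tau>. transpose (transition_matrix A t0 \<tau> t) ** transition_matrix A t0 \<tau> t)
                 has_integral H t) {t..}) \<and>
     (\<forall>A0. (\<forall>t\<ge>t0. A t = A0) \<longrightarrow>
        (\<exists>H0. ((\<lambda>\<tau>. mat_exp (\<tau> *\<^sub>R transpose A0) ** mat_exp (\<tau> *\<^sub>R A0)) has_integral H0) {0..} \<and>
              (\<forall>t\<ge>t0. H t = H0))) \<and>
     (\<forall>x. is_solution A t0 x \<longrightarrow>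
        (\<forall>t\<ge>t0.
           sqrt (lambda_min (H t0) / lambda_max (H t)) * norm (x t0) *
             exp (- (1/2) * integral {t0..t} (\<lambda>\<tau>. 1 / lambda_min (H \<tau>))) \<le> norm (x t) \<and>
           norm (x t) \<le> sqrt (lambda_max (H t0) / lambda_min (H t)) * norm (x t0) *
             exp (- (1/2) * integral {t0..t} (\<lambda>\<tau>. 1 / lambda_max (H \<tau>))))) \<and>
     (\<forall>\<gamma> lam. \<gamma> > 0 \<and> lam > 0 \<and>
        (\<forall>t \<tau>. t0 \<le> \<tau> \<and> \<tau> \<le> t \<longrightarrow>
           spectral_norm (transition_matrix A t0 t \<tau>) \<le> \<gamma> * exp (- lam * (t - \<tau>))) \<longrightarrow>
        (\<forall>t\<ge>t0. lambda_min (H t) \<le> lambda_max (H t) \<and>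
                 lambda_max (H t) \<le> \<gamma>\<^sup>2 / (2 * lam)) \<and>
        (\<forall>L. (\<forall>t\<ge>t0. spectral_norm (A t) \<le> L) \<longrightarrow>
           (\<forall>t\<ge>t0. 1 / (2 * L) \<le> lambda_min (H t) \<and>
                    lambda_min (H t) \<le> lambda_max (H t) \<and>
                    lambda_max (H t) \<le> \<gamma>\<^sup>2 / (2 * lam))))"
proof -
  \<comment> \<open>The same choice as in \<open>transition_matrix\<close>, so that the transition
    matrix unfolds to \<open>X t ** Y s\<close>.\<close>
  define X where "X = (SOME X. fundamental_matrix A t0 X)"
  define Y where "Y = (\<lambda>t. matrix_inv (X t))"
  have X: "fundamental_matrix A t0 X"
    unfolding X_def using fundamental_matrix_exists[OF assms(1)] by (rule someI_ex)
  have \<Phi>: "transition_matrix A t0 t s = X t ** Y s" for t s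
    unfolding transition_matrix_def X_def Y_def Let_def ..
  interpret fundamental_system A t0 X Y
    by unfold_locales (rule assms(1), rule X, rule Y_def)
  obtain g l where gl: "g > 0" "l > 0" and uas: "\<And>s x t. s \<ge> t0 \<Longrightarrow> is_solution A s x \<Longrightarrow> t \<ge> s \<Longrightarrow>
      norm (x t) \<le> g * norm (x s) * exp (- l * (t - s))"
    using assms(2) unfolding uniformly_asymptotically_stable_def by blast
  interpret uas_system A t0 X Y g l
  proof unfold_locales
    \<comment> \<open>Stability is applied to the solution \<open>X t *v (Y s *v v)\<close>, whose
      value at \<open>s\<close> is \<open>v\<close>.\<close>
    show "norm (X t *v (Y s *v v)) \<le> g * exp (- l * (t - s)) * norm v"
      if s: "t0 \<le> s" and t: "s \<le> t" for t s v
      using uas[OF s is_solution_X[OF s, of "Y s *v v"] t] XYv[OF s] by (simp add: mult_ac)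
  qed (rule gl(2))
  \<comment> \<open>Proved for every admissible pair of constants, not just for the pair
    \<open>g\<close>, \<open>l\<close> used to construct \<open>H\<close>.\<close>
  have upper: "lambda_max (H t) \<le> \<gamma>\<^sup>2 / (2 * lam)"
    if lam: "lam > 0" and bound: "\<And>t \<tau>. t0 \<le> \<tau> \<Longrightarrow> \<tau> \<le> t \<Longrightarrow>
        spectral_norm (transition_matrix A t0 t \<tau>) \<le> \<gamma> * exp (- lam * (t - \<tau>))" and t: "t \<ge> t0"
    for \<gamma> lam t
  proof (rule lambda_max_H_le[OF lam _ t])
    fix \<tau> v assume \<tau>: "t \<le> \<tau>"
    have "norm (X \<tau> *v (Y t *v v)) \<le> spectral_norm (X \<tau> ** Y t) * norm v"
      unfolding matrix_vector_mul_assoc spectral_norm_def by (rule onorm) simp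
    also have "\<dots> \<le> \<gamma> * exp (- lam * (\<tau> - t)) * norm v"
      using bound[OF t \<tau>] unfolding \<Phi> by (rule mult_right_mono) simp
    finally show "norm (X \<tau> *v (Y t *v v)) \<le> \<gamma> * exp (- lam * (\<tau> - t)) * norm v" .
  qed
  \<comment> \<open>All values \<open>H t\<close> are integrals of one and the same function, so
    uniqueness of the integral makes \<open>H\<close> constant.\<close>
  have const: "\<exists>H0. ((\<lambda>\<tau>. mat_exp (\<tau> *\<^sub>R transpose A0) ** mat_exp (\<tau> *\<^sub>R A0)) has_integral H0) {0..} \<and>
      (\<forall>t\<ge>t0. H t = H0)" if "\<forall>t\<ge>t0. A t = A0" for A0
    using H_constant[of A0] has_integral_unique that order_refl by meson
  have order: "lambda_min (H t) \<le> lambda_max (H t)" if "t \<ge> t0" for t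
    by (rule lambda_min_le_lambda_max[OF symmetric_H[OF that]])
  show ?thesis
  proof (rule exI[of _ H], intro conjI allI impI)
    show "continuous_on {t0..} H" by (rule continuous_on_H)
  qed (use symmetric_H positive_definite_H H_has_integral const solution_bounds upper order
      lambda_min_H_ge in \<open>simp_all add: \<Phi>\<close>)
qed

end
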